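(* There is a (possibly empty) small set of primes $T$ with the following property. For any $\epsilon>0$ there is a $C$ such that for all primes $p>C$ not in $T$, we have $$\mathbf{P}_{A,B}\left(\operatorname{diam}\left(\mathfrak{sl}_2(\mathbf{F}_p),S\right)\le 120\log p+8\right)\ge 1-\epsilon,$$ where $S=\{0,\pm A,\pm B\}$ for independent uniformly random $A,B\in\mathfrak{sl}_2(\mathbf{F}_p)$.
   Context: A small set is a set of positive integers whose sum of reciprocals converges. $\log$ is the natural logarithm. $\mathfrak{sl}_2(\mathbf{F}_p)$ is the Lie algebra of trace-zero $2\times2$ matrices over $\mathbf{F}_p$ with $[X,Y]=XY-YX$. A subset $S$ of a Lie algebra $\mathfrak g$ is symmetric if $0\in S$ and $S=-S$. For a symmetric set $S$ define inductively $S^1=S$ and, for $k\ge2$, $S^k=\bigcup_{0<j<k}\left((S^j+S^{k-j})\cup[S^j,S^{k-j}]\right)$, where for subsets $X,Y\subseteq\mathfrak g$, $X+Y=\{x+y: x\in X,y\in Y\}$ and $[X,Y]=\{[x,y]: x\in X,y\in Y\}$ (sets of individual sums and brackets). If $S$ is a symmetric generating set of a Lie algebra $\mathfrak g$ over $\mathbf{F}_p$, the diameter $\operatorname{diam}(\mathfrak g,S)$ is the smallest $k$ such that $S^k=\mathfrak g$ (it is taken to be $\infty$ if $S$ does not generate $\mathfrak g$). *)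

theory Defs
  imports
    "HOL-Probability.Probability"
    "HOL-Number_Theory.Residues"
    "HOL-Algebra.Module"
    "HOL-Algebra.AbelCoset"
begin

definition small_set :: "nat set \<Rightarrow> bool" where
  "small_set A \<longleftrightarrow> (\<forall>n\<in>A. 0 < n) \<and> (\<lambda>n. 1 / real n) summable_on A"

text \<open>
  A Lie algebra over a field is carried by the record type of modules, with the ring multiplication
  \<open>\<otimes>\<close> of the record read as the Lie bracket; the field \<open>one\<close> of the record is meaningless.
  Thus for subsets \<open>X <+>\<^bsub>L\<^esub> Y\<close> and \<open>X <#>\<^bsub>L\<^esub> Y\<close> are the sets of individual sums and of individual
  brackets.
\<close>

locale lie_algebra = field K + module K L for K (structure) and L (structure) +
  assumes bracket_closed: "\<lbrakk>x \<in> carrier L; y \<in> carrier L\<rbrakk> \<Longrightarrow> x \<otimes>\<^bsub>L\<^esub> y \<in> carrier L"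
    and bracket_add_left: "\<lbrakk>x \<in> carrier L; y \<in> carrier L; z \<in> carrier L\<rbrakk> \<Longrightarrow>
      (x \<oplus>\<^bsub>L\<^esub> y) \<otimes>\<^bsub>L\<^esub> z = x \<otimes>\<^bsub>L\<^esub> z \<oplus>\<^bsub>L\<^esub> y \<otimes>\<^bsub>L\<^esub> z"
    and bracket_add_right: "\<lbrakk>x \<in> carrier L; y \<in> carrier L; z \<in> carrier L\<rbrakk> \<Longrightarrow>
      x \<otimes>\<^bsub>L\<^esub> (y \<oplus>\<^bsub>L\<^esub> z) = x \<otimes>\<^bsub>L\<^esub> y \<oplus>\<^bsub>L\<^esub> x \<otimes>\<^bsub>L\<^esub> z"
    and bracket_smult_left: "\<lbrakk>c \<in> carrier K; x \<in> carrier L; y \<in> carrier L\<rbrakk> \<Longrightarrow>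
      (c \<odot>\<^bsub>L\<^esub> x) \<otimes>\<^bsub>L\<^esub> y = c \<odot>\<^bsub>L\<^esub> (x \<otimes>\<^bsub>L\<^esub> y)"
    and bracket_smult_right: "\<lbrakk>c \<in> carrier K; x \<in> carrier L; y \<in> carrier L\<rbrakk> \<Longrightarrow>
      x \<otimes>\<^bsub>L\<^esub> (c \<odot>\<^bsub>L\<^esub> y) = c \<odot>\<^bsub>L\<^esub> (x \<otimes>\<^bsub>L\<^esub> y)"
    and bracket_self: "x \<in> carrier L \<Longrightarrow> x \<otimes>\<^bsub>L\<^esub> x = \<zero>\<^bsub>L\<^esub>"
    and jacobi: "\<lbrakk>x \<in> carrier L; y \<in> carrier L; z \<in> carrier L\<rbrakk> \<Longrightarrow>
      x \<otimes>\<^bsub>L\<^esub> (y \<otimes>\<^bsub>L\<^esub> z) \<oplus>\<^bsub>L\<^esub> y \<otimes>\<^bsub>L\<^esub> (z \<otimes>\<^bsub>L\<^esub> x) \<oplus>\<^bsub>L\<^esub> z \<otimes>\<^bsub>L\<^esub> (x \<otimes>\<^bsub>L\<^esub> y) = \<zero>\<^bsub>L\<^esub>"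

definition lie_subalgebra :: "('a, 'm) ring_scheme \<Rightarrow> ('a, 'b, 'n) module_scheme \<Rightarrow> 'b set \<Rightarrow> bool" where
  "lie_subalgebra K L H \<longleftrightarrow>
     submodule H K L \<and> (\<forall>x\<in>H. \<forall>y\<in>H. x \<otimes>\<^bsub>L\<^esub> y \<in> H)"

definition lie_generates :: "('a, 'm) ring_scheme \<Rightarrow> ('a, 'b, 'n) module_scheme \<Rightarrow> 'b set \<Rightarrow> bool" where
  "lie_generates K L S \<longleftrightarrow> lie_subalgebra K L hull S = carrier L"

text \<open>The index \<open>k = 0\<close> is not used.\<close>

fun lie_power :: "('b, 'm) ring_scheme \<Rightarrow> 'b set \<Rightarrow> nat \<Rightarrow> 'b set" where
  "lie_power L S k =
     (if k = 0 then {}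
      else if k = 1 then S
      else (\<Union>j\<in>{0<..<k}. (lie_power L S j <+>\<^bsub>L\<^esub> lie_power L S (k - j)) \<union>
                            (lie_power L S j <#>\<^bsub>L\<^esub> lie_power L S (k - j))))"

declare lie_power.simps [simp del]

text \<open>\<open>Inf {} = \<infinity>\<close> in \<^typ>\<open>enat\<close>; otherwise the infimum is the minimum.\<close>

definition lie_diam :: "('a, 'm) ring_scheme \<Rightarrow> ('a, 'b, 'n) module_scheme \<Rightarrow> 'b set \<Rightarrow> enat" where
  "lie_diam K L S =
     (if lie_generates K L S then Inf {enat k |k. 0 < k \<and> lie_power L S k = carrier L} else \<infinity>)"

text \<open>Matrices over \<open>R\<close> have the type \<^typ>\<open>'a^2^2\<close> with all entries in \<open>carrier R\<close>.\<close>

definition mat2_mult :: "('a, 'm) ring_scheme \<Rightarrow> 'a^2^2 \<Rightarrow> 'a^2^2 \<Rightarrow> 'a^2^2" where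
  "mat2_mult R X Y = (\<chi> i j. X $ i $ 1 \<otimes>\<^bsub>R\<^esub> Y $ 1 $ j \<oplus>\<^bsub>R\<^esub> X $ i $ 2 \<otimes>\<^bsub>R\<^esub> Y $ 2 $ j)"

definition sl2 :: "('a, 'm) ring_scheme \<Rightarrow> ('a, 'a^2^2) module" where
  "sl2 R =
     \<lparr>carrier = {X. (\<forall>i j. X $ i $ j \<in> carrier R) \<and> X $ 1 $ 1 \<oplus>\<^bsub>R\<^esub> X $ 2 $ 2 = \<zero>\<^bsub>R\<^esub>},
      monoid.mult = (\<lambda>X Y. \<chi> i j. mat2_mult R X Y $ i $ j \<ominus>\<^bsub>R\<^esub> mat2_mult R Y X $ i $ j),
      one = undefined,
      zero = (\<chi> i j. \<zero>\<^bsub>R\<^esub>),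
      add = (\<lambda>X Y. \<chi> i j. X $ i $ j \<oplus>\<^bsub>R\<^esub> Y $ i $ j),
      smult = (\<lambda>c X. \<chi> i j. c \<otimes>\<^bsub>R\<^esub> X $ i $ j)\<rparr>"

abbreviation sl2_Fp :: "nat \<Rightarrow> (int, int^2^2) module" where
  "sl2_Fp p \<equiv> sl2 (residue_ring (int p))"

definition sym_pair :: "('b, 'm) ring_scheme \<Rightarrow> 'b \<Rightarrow> 'b \<Rightarrow> 'b set" where
  "sym_pair L A B = {\<zero>\<^bsub>L\<^esub>, A, \<ominus>\<^bsub>L\<^esub> A, B, \<ominus>\<^bsub>L\<^esub> B}"

lemma carrier_sl2: "X \<in> carrier (sl2 R) \<longleftrightarrow>
    (\<forall>i j. X $ i $ j \<in> carrier R) \<and> X $ 1 $ 1 \<oplus>\<^bsub>R\<^esub> X $ 2 $ 2 = \<zero>\<^bsub>R\<^esub>"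
  by (simp add: sl2_def)

lemma sl2_sel:
  "\<zero>\<^bsub>sl2 R\<^esub> $ i $ j = \<zero>\<^bsub>R\<^esub>"
  "(X \<oplus>\<^bsub>sl2 R\<^esub> Y) $ i $ j = X $ i $ j \<oplus>\<^bsub>R\<^esub> Y $ i $ j"
  "(c \<odot>\<^bsub>sl2 R\<^esub> X) $ i $ j = c \<otimes>\<^bsub>R\<^esub> X $ i $ j"
  "(X \<otimes>\<^bsub>sl2 R\<^esub> Y) $ i $ j =
     (X $ i $ 1 \<otimes>\<^bsub>R\<^esub> Y $ 1 $ j \<oplus>\<^bsub>R\<^esub> X $ i $ 2 \<otimes>\<^bsub>R\<^esub> Y $ 2 $ j) \<ominus>\<^bsub>R\<^esub>
     (Y $ i $ 1 \<otimes>\<^bsub>R\<^esub> X $ 1 $ j \<oplus>\<^bsub>R\<^esub> Y $ i $ 2 \<otimes>\<^bsub>R\<^esub> X $ 2 $ j)"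
  by (simp_all add: sl2_def mat2_mult_def)

lemma lie_algebra_sl2:
  fixes R :: "('a, 'm) ring_scheme"
  assumes "field R"
  shows "lie_algebra R (sl2 R)"
proof -
  interpret field R by fact
  have ab: "abelian_group (sl2 R)"
  proof (rule abelian_groupI)
    fix x assume x: "x \<in> carrier (sl2 R)"
    define y :: "'a^2^2" where "y = (\<chi> i j. \<ominus>\<^bsub>R\<^esub> (x $ i $ j))"
    have "y \<in> carrier (sl2 R)" "y \<oplus>\<^bsub>sl2 R\<^esub> x = \<zero>\<^bsub>sl2 R\<^esub>"
      using x by (auto simp: y_def carrier_sl2 sl2_sel vec_eq_iff l_neg minus_add[symmetric])
    then show "\<exists>y\<in>carrier (sl2 R). y \<oplus>\<^bsub>sl2 R\<^esub> x = \<zero>\<^bsub>sl2 R\<^esub>" by blast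
  next
    fix x y assume xy: "x \<in> carrier (sl2 R)" "y \<in> carrier (sl2 R)"
    then have c: "\<And>i j. x $ i $ j \<in> carrier R" "\<And>i j. y $ i $ j \<in> carrier R"
      and t: "x $ 1 $ 1 \<oplus>\<^bsub>R\<^esub> x $ 2 $ 2 = \<zero>\<^bsub>R\<^esub>" "y $ 1 $ 1 \<oplus>\<^bsub>R\<^esub> y $ 2 $ 2 = \<zero>\<^bsub>R\<^esub>"
      by (auto simp: carrier_sl2)
    have "(x $ 1 $ 1 \<oplus>\<^bsub>R\<^esub> y $ 1 $ 1) \<oplus>\<^bsub>R\<^esub> (x $ 2 $ 2 \<oplus>\<^bsub>R\<^esub> y $ 2 $ 2)
        = (x $ 1 $ 1 \<oplus>\<^bsub>R\<^esub> x $ 2 $ 2) \<oplus>\<^bsub>R\<^esub> (y $ 1 $ 1 \<oplus>\<^bsub>R\<^esub> y $ 2 $ 2)"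
      using c by (simp add: a_ac)
    then show "x \<oplus>\<^bsub>sl2 R\<^esub> y \<in> carrier (sl2 R)"
      using c t by (simp add: carrier_sl2 sl2_sel)
  qed (auto simp: carrier_sl2 sl2_sel vec_eq_iff a_ac)
  have sm: "module R (sl2 R)"
    using is_cring ab
    by (rule moduleI)
       (auto simp: carrier_sl2 sl2_sel vec_eq_iff l_distr r_distr m_assoc simp flip: r_distr)
  show ?thesis
  proof (intro lie_algebra.intro lie_algebra_axioms.intro assms sm)
    fix x y z assume "x \<in> carrier (sl2 R)" "y \<in> carrier (sl2 R)" "z \<in> carrier (sl2 R)"
    then have [simp]: "\<And>i j. x $ i $ j \<in> carrier R" "\<And>i j. y $ i $ j \<in> carrier R"
       "\<And>i j. z $ i $ j \<in> carrier R"
      by (auto simp: carrier_sl2)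
    show "(x \<oplus>\<^bsub>sl2 R\<^esub> y) \<otimes>\<^bsub>sl2 R\<^esub> z = x \<otimes>\<^bsub>sl2 R\<^esub> z \<oplus>\<^bsub>sl2 R\<^esub> y \<otimes>\<^bsub>sl2 R\<^esub> z"
      by (simp add: vec_eq_iff sl2_sel cring_simprules)
    show "x \<otimes>\<^bsub>sl2 R\<^esub> (y \<oplus>\<^bsub>sl2 R\<^esub> z) = x \<otimes>\<^bsub>sl2 R\<^esub> y \<oplus>\<^bsub>sl2 R\<^esub> x \<otimes>\<^bsub>sl2 R\<^esub> z"
      by (simp add: vec_eq_iff sl2_sel cring_simprules)
    show "x \<otimes>\<^bsub>sl2 R\<^esub> (y \<otimes>\<^bsub>sl2 R\<^esub> z) \<oplus>\<^bsub>sl2 R\<^esub> y \<otimes>\<^bsub>sl2 R\<^esub> (z \<otimes>\<^bsub>sl2 R\<^esub> x) \<oplus>\<^bsub>sl2 R\<^esub> z \<otimes>\<^bsub>sl2 R\<^esub> (x \<otimes>\<^bsub>sl2 R\<^esub> y) = \<zero>\<^bsub>sl2 R\<^esub>"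
    proof -
      have nest: "(u \<otimes>\<^bsub>sl2 R\<^esub> (v \<otimes>\<^bsub>sl2 R\<^esub> w)) $ i $ j =
          pos u v w i j \<ominus>\<^bsub>R\<^esub> pos u w v i j"
        if pos: "pos = (\<lambda>u v w i j.
             u $ i $ 1 \<otimes>\<^bsub>R\<^esub> (v $ 1 $ 1 \<otimes>\<^bsub>R\<^esub> w $ 1 $ j \<oplus>\<^bsub>R\<^esub> v $ 1 $ 2 \<otimes>\<^bsub>R\<^esub> w $ 2 $ j) \<oplus>\<^bsub>R\<^esub>
             u $ i $ 2 \<otimes>\<^bsub>R\<^esub> (v $ 2 $ 1 \<otimes>\<^bsub>R\<^esub> w $ 1 $ j \<oplus>\<^bsub>R\<^esub> v $ 2 $ 2 \<otimes>\<^bsub>R\<^esub> w $ 2 $ j) \<oplus>\<^bsub>R\<^esub>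
             ((w $ i $ 1 \<otimes>\<^bsub>R\<^esub> v $ 1 $ 1 \<oplus>\<^bsub>R\<^esub> w $ i $ 2 \<otimes>\<^bsub>R\<^esub> v $ 2 $ 1) \<otimes>\<^bsub>R\<^esub> u $ 1 $ j \<oplus>\<^bsub>R\<^esub>
              (w $ i $ 1 \<otimes>\<^bsub>R\<^esub> v $ 1 $ 2 \<oplus>\<^bsub>R\<^esub> w $ i $ 2 \<otimes>\<^bsub>R\<^esub> v $ 2 $ 2) \<otimes>\<^bsub>R\<^esub> u $ 2 $ j))"
          and [simp]: "\<And>i j. u $ i $ j \<in> carrier R" "\<And>i j. v $ i $ j \<in> carrier R"
            "\<And>i j. w $ i $ j \<in> carrier R"
        for pos u v w and i j :: 2
        by (simp add: pos sl2_sel cring_simprules)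
      have sum3: "(a \<ominus>\<^bsub>R\<^esub> a') \<oplus>\<^bsub>R\<^esub> (b \<ominus>\<^bsub>R\<^esub> b') \<oplus>\<^bsub>R\<^esub> (c \<ominus>\<^bsub>R\<^esub> c') = \<zero>\<^bsub>R\<^esub>"
        if [simp]: "a \<in> carrier R" "a' \<in> carrier R" "b \<in> carrier R" "b' \<in> carrier R"
            "c \<in> carrier R" "c' \<in> carrier R"
          and e: "a \<oplus>\<^bsub>R\<^esub> b \<oplus>\<^bsub>R\<^esub> c = a' \<oplus>\<^bsub>R\<^esub> b' \<oplus>\<^bsub>R\<^esub> c'" for a a' b b' c c'
      proof -
        have "(a \<ominus>\<^bsub>R\<^esub> a') \<oplus>\<^bsub>R\<^esub> (b \<ominus>\<^bsub>R\<^esub> b') \<oplus>\<^bsub>R\<^esub> (c \<ominus>\<^bsub>R\<^esub> c') =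
            (a \<oplus>\<^bsub>R\<^esub> b \<oplus>\<^bsub>R\<^esub> c) \<ominus>\<^bsub>R\<^esub> (a' \<oplus>\<^bsub>R\<^esub> b' \<oplus>\<^bsub>R\<^esub> c')"
          by (simp add: cring_simprules)
        then show ?thesis
          by (simp add: e minus_eq r_neg)
      qed
      show ?thesis
        unfolding vec_eq_iff sl2_sel(1,2)
        by (intro allI, unfold nest[OF refl \<open>\<And>i j. x $ i $ j \<in> carrier R\<close> \<open>\<And>i j. y $ i $ j \<in> carrier R\<close> \<open>\<And>i j. z $ i $ j \<in> carrier R\<close>]
              nest[OF refl \<open>\<And>i j. y $ i $ j \<in> carrier R\<close> \<open>\<And>i j. z $ i $ j \<in> carrier R\<close> \<open>\<And>i j. x $ i $ j \<in> carrier R\<close>]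
              nest[OF refl \<open>\<And>i j. z $ i $ j \<in> carrier R\<close> \<open>\<And>i j. x $ i $ j \<in> carrier R\<close> \<open>\<And>i j. y $ i $ j \<in> carrier R\<close>],
            rule sum3) (simp_all add: l_distr r_distr a_ac m_ac)
    qed
  next
    fix x y assume "x \<in> carrier (sl2 R)" "y \<in> carrier (sl2 R)"
    then have [simp]: "\<And>i j. x $ i $ j \<in> carrier R" "\<And>i j. y $ i $ j \<in> carrier R"
      by (auto simp: carrier_sl2)
    show "x \<otimes>\<^bsub>sl2 R\<^esub> y \<in> carrier (sl2 R)"
      by (simp add: carrier_sl2 sl2_sel cring_simprules)
    show "x \<otimes>\<^bsub>sl2 R\<^esub> x = \<zero>\<^bsub>sl2 R\<^esub>"
      by (simp add: vec_eq_iff sl2_sel cring_simprules)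
    fix c assume [simp]: "c \<in> carrier R"
    show "(c \<odot>\<^bsub>sl2 R\<^esub> x) \<otimes>\<^bsub>sl2 R\<^esub> y = c \<odot>\<^bsub>sl2 R\<^esub> (x \<otimes>\<^bsub>sl2 R\<^esub> y)"
      by (simp add: vec_eq_iff sl2_sel cring_simprules)
    show "x \<otimes>\<^bsub>sl2 R\<^esub> (c \<odot>\<^bsub>sl2 R\<^esub> y) = c \<odot>\<^bsub>sl2 R\<^esub> (x \<otimes>\<^bsub>sl2 R\<^esub> y)"
      by (simp add: vec_eq_iff sl2_sel cring_simprules)
  qed
qed

lemma sl2_finite_nonempty:
  fixes R :: "('a, 'm) ring_scheme"
  assumes "ring R" "finite (carrier R)"
  shows "finite (carrier (sl2 R))" "carrier (sl2 R) \<noteq> {}"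
proof -
  interpret ring R by fact
  let ?f = "\<lambda>X :: 'a^2^2. (X $ 1 $ 1, X $ 1 $ 2, X $ 2 $ 1, X $ 2 $ 2)"
  have "?f ` carrier (sl2 R) \<subseteq> carrier R \<times> carrier R \<times> carrier R \<times> carrier R"
    by (auto simp: carrier_sl2)
  moreover have "inj_on ?f (carrier (sl2 R))"
    by (auto simp: inj_on_def vec_eq_iff forall_2)
  ultimately show "finite (carrier (sl2 R))"
    using assms(2) by (meson finite_SigmaI inj_on_finite)
  have "\<zero>\<^bsub>sl2 R\<^esub> \<in> carrier (sl2 R)"
    by (simp add: carrier_sl2 sl2_sel)
  then show "carrier (sl2 R) \<noteq> {}" by blast
qed

lemma sym_pair_symmetric:
  assumes "lie_algebra K L" "A \<in> carrier L" "B \<in> carrier L"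
  shows "\<zero>\<^bsub>L\<^esub> \<in> sym_pair L A B" "(\<lambda>x. \<ominus>\<^bsub>L\<^esub> x) ` sym_pair L A B = sym_pair L A B"
proof -
  interpret lie_algebra K L by fact
  show "\<zero>\<^bsub>L\<^esub> \<in> sym_pair L A B" by (simp add: sym_pair_def)
  show "(\<lambda>x. \<ominus>\<^bsub>L\<^esub> x) ` sym_pair L A B = sym_pair L A B"
  proof -
    have zero: "\<ominus>\<^bsub>L\<^esub> \<zero>\<^bsub>L\<^esub> = \<zero>\<^bsub>L\<^esub>"
      by simp
    show ?thesis
      using assms(2,3) by (simp add: sym_pair_def zero insert_commute)
  qed
qed

end

theory Submission
  imports Defs "HOL-Real_Asymp.Real_Asymp"
begin

text \<open>
  The statement holds for every large prime, so the exceptional set is taken to be empty.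

  Let \<open>C = [A, B]\<close>. Since \<open>C\<close> is orthogonal to \<open>A\<close> under the trace form, it is an eigenvector of
  \<open>(ad A)\<^sup>2\<close>, with eigenvalue \<open>\<lambda> = - 4 det A\<close>. Applying \<open>(ad A)\<^sup>2\<close> costs two brackets, so Horner's
  rule writes \<open>f(\<lambda>) C\<close>, for a polynomial \<open>f\<close> with \<open>n\<close> coefficients in \<open>{0, 1}\<close>, as an element of
  \<open>S\<^bsup>4n - 2\<^esup>\<close>. Choose \<open>n\<close> with \<open>2\<^sup>n \<le> p < 2\<^bsup>n + 1\<^esup>\<close>. Two distinct such polynomials agree at no more
  than \<open>n\<close> points modulo \<open>p\<close>, so on average over \<open>\<lambda>\<close> there are few collisions, and for all but a
  small proportion of \<open>\<lambda>\<close> the set \<open>X\<close> of values has at least about \<open>p / log p\<close> elements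
  (lemma \<open>few_bases_with_few_values\<close>).

  This is not all of the field, but the bracket of two multiples of fixed vectors multiplies the
  coefficients: \<open>[x C, [A, y C]]\<close> is \<open>x y\<close> times a fixed multiple of \<open>A\<close>. A set of more than
  \<open>p\<^bsup>3/4\<^esup>\<close> nonzero residues, together with \<open>0\<close>, represents every residue as \<open>x y + z w\<close>
  (lemma \<open>sums_of_two_products_cover\<close>, a second moment argument for points and lines in the affine
  plane). This yields all multiples of \<open>A\<close>, likewise all multiples of \<open>B\<close>, and, by bracketing those
  with \<open>A\<close>, all multiples of \<open>C\<close>. The scalar by which the products are multiplied is, up to a factor
  \<open>- 4\<close>, the determinant of \<open>A, B, C\<close>, so when it is nonzero these three vectors form a basis and
  the whole algebra is \<open>S\<^bsup>48n - 17\<^esup>\<close> (lemma \<open>sl2_Fp_covered\<close>). The constant \<open>120\<close> is generous, as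
  \<open>48 / log 2 < 72\<close>.

  For uniform \<open>A\<close> the eigenvalue is nearly uniform, and for fixed \<open>A\<close> the determinant is a quadratic
  polynomial in an entry of \<open>B\<close>; hence degenerate pairs are rare
  (lemma \<open>card_degenerate_pairs_le\<close>).
\<close>

section \<open>Powers of a symmetric set in a Lie algebra\<close>

lemma lie_power_1: "lie_power L S (Suc 0) = S"
  by (subst lie_power.simps) simp

lemma lie_power_addI:
  assumes "x \<in> lie_power L S i" "y \<in> lie_power L S j" "0 < i" "0 < j"
  shows "x \<oplus>\<^bsub>L\<^esub> y \<in> lie_power L S (i + j)"
proof -
  have "x \<oplus>\<^bsub>L\<^esub> y \<in> lie_power L S i <+>\<^bsub>L\<^esub> lie_power L S (i + j - i)"
    using assms by (auto simp: set_add_def')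
  then show ?thesis
    using assms by (subst lie_power.simps) (auto intro!: bexI[of _ i])
qed

lemma lie_power_bracketI:
  assumes "x \<in> lie_power L S i" "y \<in> lie_power L S j" "0 < i" "0 < j"
  shows "x \<otimes>\<^bsub>L\<^esub> y \<in> lie_power L S (i + j)"
proof -
  have "x \<otimes>\<^bsub>L\<^esub> y \<in> lie_power L S i <#>\<^bsub>L\<^esub> lie_power L S (i + j - i)"
    using assms by (auto simp: set_mult_def)
  then show ?thesis
    using assms by (subst lie_power.simps) (auto intro!: bexI[of _ i])
qed

text \<open>
  In particular a set whose power is the whole algebra generates it, so the diameter is then finite.
\<close>
lemma lie_power_subset_subalgebra:
  assumes sub: "lie_subalgebra K L H" and S: "S \<subseteq> H"
  shows "lie_power L S k \<subseteq> H"
proof (induction k rule: less_induct)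
  case (less k)
  have add: "x \<oplus>\<^bsub>L\<^esub> y \<in> H" and br: "x \<otimes>\<^bsub>L\<^esub> y \<in> H" if "x \<in> H" "y \<in> H" for x y
    using sub that unfolding lie_subalgebra_def submodule_def
    by (auto dest: subgroup.m_closed)
  show ?case
  proof
    fix x assume x: "x \<in> lie_power L S k"
    consider "k = 0" | "k = 1" | "1 < k" by linarith
    then show "x \<in> H"
    proof cases
      case 3
      then obtain j where j: "0 < j" "j < k"
        and xj: "x \<in> lie_power L S j <+>\<^bsub>L\<^esub> lie_power L S (k - j) \<or>
             x \<in> lie_power L S j <#>\<^bsub>L\<^esub> lie_power L S (k - j)"
        using x by (subst (asm) lie_power.simps) auto
      have "lie_power L S j \<subseteq> H" "lie_power L S (k - j) \<subseteq> H"
        using j less by simp_all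
      then have "u \<oplus>\<^bsub>L\<^esub> v \<in> H" "u \<otimes>\<^bsub>L\<^esub> v \<in> H"
        if "u \<in> lie_power L S j" "v \<in> lie_power L S (k - j)" for u v
        using that by (meson add br subsetD)+
      then show ?thesis
        using xj by (auto simp: set_add_def' set_mult_def)
    qed (use x S in \<open>auto simp: lie_power.simps[of L S 0] lie_power_1\<close>)
  qed
qed

lemma (in lie_algebra) lie_subalgebra_carrier: "lie_subalgebra K L (carrier L)"
  unfolding lie_subalgebra_def using carrier_is_submodule bracket_closed by blast

lemma (in lie_algebra) lie_power_mono:
  assumes S: "\<zero>\<^bsub>L\<^esub> \<in> S" "S \<subseteq> carrier L" and k: "0 < k" "k \<le> m"
  shows "lie_power L S k \<subseteq> lie_power L S m"
  using k(2)
proof (induction m rule: dec_induct)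
  case (step m)
  have "x \<in> lie_power L S (Suc m)" if x: "x \<in> lie_power L S m" for x
  proof -
    have "x \<oplus>\<^bsub>L\<^esub> \<zero>\<^bsub>L\<^esub> \<in> lie_power L S (m + 1)"
      using x S k(1) step.hyps by (intro lie_power_addI) (auto simp: lie_power_1)
    moreover have "x \<in> carrier L"
      using lie_power_subset_subalgebra[OF lie_subalgebra_carrier S(2)] x by blast
    ultimately show ?thesis by simp
  qed
  then show ?case using step.IH by blast
qed simp

lemma (in lie_algebra) lie_diam_le:
  assumes S: "S \<subseteq> carrier L" and k: "0 < k" "carrier L \<subseteq> lie_power L S k"
  shows "lie_diam K L S \<le> enat k"
proof -
  have eq: "lie_power L S k = carrier L"
    using k lie_power_subset_subalgebra[OF lie_subalgebra_carrier S] by blast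
  have "carrier L \<subseteq> H" if "lie_subalgebra K L H" "S \<subseteq> H" for H
    using lie_power_subset_subalgebra[OF that] eq by blast
  then have "lie_generates K L S"
    unfolding lie_generates_def hull_def using lie_subalgebra_carrier S by blast
  then show ?thesis
    unfolding lie_diam_def using eq k by (auto intro!: Inf_lower)
qed

section \<open>Coordinates on trace-zero matrices modulo a prime\<close>

text \<open>
  The matrix with rows \<open>(a, b)\<close> and \<open>(c, - a)\<close>. The coordinates are arbitrary integers, reduced
  modulo \<open>p\<close> only in the entries, so that identities between brackets become polynomial identities
  over the integers.
\<close>
definition sl2_mat :: "nat \<Rightarrow> int \<Rightarrow> int \<Rightarrow> int \<Rightarrow> int^2^2" where
  "sl2_mat p a b c =
     (\<chi> i j. (if i = 1 then if j = 1 then a else b else if j = 1 then c else - a) mod int p)"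

context
  fixes p :: nat
  assumes p: "prime p"
begin

interpretation residues "int p" "residue_ring (int p)"
  using prime_gt_1_nat[OF p] by unfold_locales auto

lemma field_residue_ring: "field (residue_ring (int p))"
proof -
  interpret residues_prime p "residue_ring (int p)"
    using p by unfold_locales auto
  show ?thesis by (rule is_field)
qed

lemma sl2_mat_eq_iff:
  "sl2_mat p a b c = sl2_mat p a' b' c' \<longleftrightarrow>
     [a = a'] (mod int p) \<and> [b = b'] (mod int p) \<and> [c = c'] (mod int p)"
  by (auto simp: sl2_mat_def vec_eq_iff forall_2 cong_def intro: mod_minus_cong)

lemma carrier_sl2_Fp: "carrier (sl2_Fp p) = {sl2_mat p a b c |a b c. True}"
proof (intro equalityI subsetI)
  fix X assume X: "X \<in> carrier (sl2_Fp p)"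
  have bd: "X $ i $ j mod int p = X $ i $ j" for i j
    using X by (simp add: carrier_sl2 res_carrier_eq)
  have "(X $ 1 $ 1 + X $ 2 $ 2) mod int p = 0"
    using X by (simp add: carrier_sl2 res_add_eq res_zero_eq)
  then have "(- X $ 1 $ 1) mod int p = X $ 2 $ 2 mod int p"
    by (simp flip: cong_def add: cong_iff_dvd_diff mod_eq_0_iff_dvd) 
       (metis add.commute dvd_minus_iff minus_add_distrib uminus_add_conv_diff minus_diff_eq diff_minus_eq_add)
  then have "X = sl2_mat p (X $ 1 $ 1) (X $ 1 $ 2) (X $ 2 $ 1)"
    using bd by (simp add: sl2_mat_def vec_eq_iff forall_2)
  then show "X \<in> {sl2_mat p a b c |a b c. True}" by blast
qed (use m_gt_one in \<open>auto simp: sl2_mat_def carrier_sl2 forall_2 res_carrier_eq res_add_eq res_zero_eq mod_simps\<close>)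

lemma sl2_mat_add:
  "sl2_mat p a b c \<oplus>\<^bsub>sl2_Fp p\<^esub> sl2_mat p d e f = sl2_mat p (a + d) (b + e) (c + f)"
  by (simp add: sl2_mat_def sl2_sel vec_eq_iff forall_2 res_add_eq mod_simps)

lemma sl2_mat_zero: "\<zero>\<^bsub>sl2_Fp p\<^esub> = sl2_mat p 0 0 0"
  by (simp add: sl2_mat_def sl2_sel vec_eq_iff forall_2 res_zero_eq)

lemma sl2_mat_bracket:
  "sl2_mat p a b c \<otimes>\<^bsub>sl2_Fp p\<^esub> sl2_mat p d e f =
     sl2_mat p (b * f - c * e) (2 * (a * e - b * d)) (2 * (c * d - a * f))"
  by (simp add: sl2_mat_def sl2_sel vec_eq_iff forall_2 res_add_eq res_mult_eq res_neg_eq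
      a_minus_def mod_simps) (simp add: algebra_simps)

end

section \<open>Sums of two products modulo a prime\<close>

text \<open>
  This is the second moment method. If \<open>g u\<close> counts the neighbours of \<open>u\<close> in \<open>P\<close>, then the mean of
  \<open>g\<close> over \<open>U\<close> is \<open>card P / q\<close>, and the degree and codegree bounds show that the squared deviations
  from the mean add up to no more than \<open>q * card P\<close>. Each \<open>u\<close> without neighbours contributes
  \<open>(card P / q)\<^sup>2\<close>, so such \<open>u\<close> are few.
\<close>
lemma few_common_neighbours_bound:
  fixes R :: "'a \<Rightarrow> 'b \<Rightarrow> bool" and q :: nat
  assumes fin: "finite U" "finite P" and U: "card U = q\<^sup>2"
    and deg: "\<And>v. v \<in> P \<Longrightarrow> card {u\<in>U. R u v} = q"
    and codeg: "\<And>v v'. v \<in> P \<Longrightarrow> v' \<in> P \<Longrightarrow> v \<noteq> v' \<Longrightarrow> card {u\<in>U. R u v \<and> R u v'} \<le> 1"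
    and Q: "Q \<subseteq> U" "\<And>u v. u \<in> Q \<Longrightarrow> v \<in> P \<Longrightarrow> \<not> R u v"
  shows "card Q * card P \<le> q ^ 3"
proof (cases "P = {}")
  case False
  define g where "g u = (\<Sum>v\<in>P. of_bool (R u v) :: real)" for u
  let ?m = "real (card P)"
  have "(\<Sum>u\<in>U. g u) = (\<Sum>v\<in>P. \<Sum>u\<in>U. of_bool (R u v))"
    unfolding g_def by (rule sum.swap)
  also have "\<dots> = (\<Sum>v\<in>P. real q)"
  proof (rule sum.cong[OF refl])
    fix v assume v: "v \<in> P"
    have "(\<Sum>u\<in>U. of_bool (R u v) :: real) = real (card {u\<in>U. R u v})"
      using fin(1) by (simp add: sum.If_cases Int_def of_bool_def)
    then show "(\<Sum>u\<in>U. of_bool (R u v) :: real) = real q"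
      by (simp add: deg[OF v])
  qed
  finally have first: "(\<Sum>u\<in>U. g u) = q * ?m" by simp
  have "(\<Sum>u\<in>U. (g u)\<^sup>2) = (\<Sum>u\<in>U. \<Sum>v\<in>P. \<Sum>v'\<in>P. of_bool (R u v \<and> R u v'))"
    unfolding g_def power2_eq_square sum_product by (simp add: of_bool_conj)
  also have "\<dots> = (\<Sum>v\<in>P. \<Sum>v'\<in>P. \<Sum>u\<in>U. of_bool (R u v \<and> R u v'))"
    by (subst sum.swap, rule sum.cong[OF refl], rule sum.swap)
  also have "\<dots> \<le> (\<Sum>v\<in>P. \<Sum>v'\<in>P. (if v' = v then real q else 0) + 1)"
  proof (intro sum_mono)
    fix v v' assume v: "v \<in> P" "v' \<in> P"
    have "(\<Sum>u\<in>U. of_bool (R u v \<and> R u v') :: real) = real (card {u\<in>U. R u v \<and> R u v'})"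
      using fin(1) by (simp add: sum.If_cases Int_def of_bool_def)
    also have "\<dots> \<le> (if v' = v then real q else 0) + 1"
      using deg[of v] codeg[of v v'] v by auto
    finally show "(\<Sum>u\<in>U. of_bool (R u v \<and> R u v') :: real) \<le> (if v' = v then real q else 0) + 1" .
  qed
  also have "\<dots> = q * ?m + ?m\<^sup>2"
    using fin(2) by (simp add: sum.distrib power2_eq_square algebra_simps)
  finally have second: "(\<Sum>u\<in>U. (g u)\<^sup>2) \<le> q * ?m + ?m\<^sup>2" .
  have "real (card Q) * ?m\<^sup>2 = (\<Sum>u\<in>Q. (q * g u - ?m)\<^sup>2)"
    using Q(2) by (simp add: g_def)
  also have "\<dots> \<le> (\<Sum>u\<in>U. (q * g u - ?m)\<^sup>2)"
    using fin(1) Q(1) by (intro sum_mono2) auto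
  also have "\<dots> = (\<Sum>u\<in>U. q\<^sup>2 * (g u)\<^sup>2 - 2 * q * ?m * g u + ?m\<^sup>2)"
    by (intro sum.cong) (auto simp: power2_eq_square algebra_simps)
  also have "\<dots> = q\<^sup>2 * (\<Sum>u\<in>U. (g u)\<^sup>2) - 2 * q * ?m * (\<Sum>u\<in>U. g u) + q\<^sup>2 * ?m\<^sup>2"
    by (simp add: sum.distrib sum_subtractf sum_distrib_left U)
  also have "\<dots> \<le> q\<^sup>2 * (q * ?m + ?m\<^sup>2) - 2 * q * ?m * (q * ?m) + q\<^sup>2 * ?m\<^sup>2"
    unfolding first using second by (intro add_mono diff_mono mult_left_mono) auto
  also have "\<dots> = q ^ 3 * ?m"
    by (simp add: power2_eq_square power3_eq_cube algebra_simps)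
  finally have "(real (card Q) * ?m) * ?m \<le> real (q ^ 3) * ?m"
    by (simp add: power2_eq_square mult.assoc)
  moreover have "0 < ?m" using False fin(2) by (simp add: card_gt_0_iff)
  ultimately have "real (card Q * card P) \<le> real (q ^ 3)"
    by (simp add: mult_le_cancel_right)
  then show ?thesis by (simp only: of_nat_le_iff)
qed simp

lemma inverse_mod_prime:
  fixes a :: int
  assumes "prime p" "\<not> int p dvd a"
  obtains b where "[a * b = 1] (mod int p)"
proof -
  have "coprime a (int p)"
    using assms by (metis coprime_commute prime_imp_coprime prime_nat_int_transfer)
  then show ?thesis using cong_solve_coprime_int that by blast
qed

lemma card_points_on_line_mod_prime:
  fixes y w t :: int
  assumes p: "prime p" and y: "\<not> int p dvd y"
  shows "card {u \<in> {0..<int p} \<times> {0..<int p}. [fst u * y + snd u * w = t] (mod int p)} = p"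
proof -
  obtain y' where y': "[y * y' = 1] (mod int p)"
    using inverse_mod_prime[OF p y] .
  have p0: "0 < int p" using prime_gt_0_nat[OF p] by simp
  let ?S = "{u \<in> {0..<int p} \<times> {0..<int p}. [fst u * y + snd u * w = t] (mod int p)}"
  have "bij_betw snd ?S {0..<int p}"
  proof (rule bij_betw_byWitness[where f' = "\<lambda>z. ((t - z * w) * y' mod int p, z)"])
    show "\<forall>u\<in>?S. ((t - snd u * w) * y' mod int p, snd u) = u"
    proof
      fix u assume u: "u \<in> ?S"
      have "[fst u * y + snd u * w = t] (mod int p)" using u by simp
      then have "[(t - snd u * w) * y' = (fst u * y + snd u * w - snd u * w) * y'] (mod int p)"
        by (intro cong_mult cong_diff) (auto simp: cong_sym)
      also have "(fst u * y + snd u * w - snd u * w) * y' = fst u * (y * y')" by simp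
      also have "[\<dots> = fst u * 1] (mod int p)" using y' by (intro cong_mult) auto
      finally show "((t - snd u * w) * y' mod int p, snd u) = u"
        using u by (auto simp: cong_def prod_eq_iff)
    qed
    show "(\<lambda>z. ((t - z * w) * y' mod int p, z)) ` {0..<int p} \<subseteq> ?S"
    proof (rule image_subsetI)
      fix z :: int assume z: "z \<in> {0..<int p}"
      have "[(t - z * w) * y' mod int p * y + z * w = (t - z * w) * y' * y + z * w] (mod int p)"
        by (intro cong_add cong_mult) (auto simp: cong_def)
      also have "(t - z * w) * y' * y + z * w = (t - z * w) * (y * y') + z * w"
        by (simp add: mult_ac)
      also have "[(t - z * w) * (y * y') + z * w = (t - z * w) * 1 + z * w] (mod int p)"
        using y' by (intro cong_add cong_mult) auto
      finally show "((t - z * w) * y' mod int p, z) \<in> ?S"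
        using p0 z by simp
    qed
  qed auto
  then show ?thesis by (auto dest: bij_betw_same_card)
qed

text \<open>
  Lines \<open>x y + z w = t\<close> that avoid the origin and have different coefficient vectors are different:
  two common points force the coefficient vectors to be proportional, and the common nonzero
  right-hand side \<open>t\<close> then forces them to be equal.
\<close>
lemma card_common_points_of_lines_mod_prime_le:
  fixes y w y' w' t :: int
  assumes p: "prime p" and t: "\<not> int p dvd t"
    and ne: "(y, w) \<noteq> (y', w')" and range: "y \<in> {0..<int p}" "w \<in> {0..<int p}" "y' \<in> {0..<int p}" "w' \<in> {0..<int p}"
  shows "card {u \<in> {0..<int p} \<times> {0..<int p}. [fst u * y + snd u * w = t] (mod int p) \<and>
      [fst u * y' + snd u * w' = t] (mod int p)} \<le> 1" (is "card ?S \<le> 1")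
proof -
  have pp: "prime (int p)" using p by simp
  have eqI: "a = b" if "int p dvd a - b" "a \<in> {0..<int p}" "b \<in> {0..<int p}" for a b
    using that by (auto simp flip: cong_iff_dvd_diff simp: cong_def)
  have "u = v" if uv: "u \<in> ?S" "v \<in> ?S" for u v
  proof (rule ccontr)
    obtain x z x' z' where [simp]: "u = (x, z)" "v = (x', z')" by fastforce
    assume "u \<noteq> v"
    then have "\<not> int p dvd x - x' \<or> \<not> int p dvd z - z'"
      using eqI[of x x'] eqI[of z z'] uv by auto
    have d: "int p dvd x * y + z * w - t" "int p dvd x' * y + z' * w - t"
       "int p dvd x * y' + z * w' - t" "int p dvd x' * y' + z' * w' - t"
      using uv by (auto simp: cong_iff_dvd_diff)
    define D where "D = y * w' - y' * w"
    have "(x - x') * D = ((x * y + z * w - t) - (x' * y + z' * w - t)) * w' -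
          ((x * y' + z * w' - t) - (x' * y' + z' * w' - t)) * w"
      by (simp add: D_def algebra_simps)
    then have 1: "int p dvd (x - x') * D" using d by (simp only: dvd_diff dvd_mult2)
    have "(z - z') * D = ((x * y' + z * w' - t) - (x' * y' + z' * w' - t)) * y -
         ((x * y + z * w - t) - (x' * y + z' * w - t)) * y'"
      by (simp add: D_def algebra_simps)
    then have 2: "int p dvd (z - z') * D" using d by (simp only: dvd_diff dvd_mult2)
    have D: "int p dvd D"
      using 1 2 \<open>\<not> int p dvd x - x' \<or> \<not> int p dvd z - z'\<close> pp by (auto simp: prime_dvd_mult_iff)
    have "t * (y - y') = z * D - (x * y + z * w - t) * (- y') - (x * y' + z * w' - t) * y"
      by (simp add: D_def algebra_simps)
    then have "int p dvd t * (y - y')"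
      using D d by (simp add: dvd_diff dvd_mult dvd_mult2)
    moreover have "t * (w - w') = - (x * D) - (x * y + z * w - t) * (- w') - (x * y' + z * w' - t) * w"
      by (simp add: D_def algebra_simps)
    then have "int p dvd t * (w - w')"
      using D d by (simp add: dvd_diff dvd_mult dvd_mult2)
    ultimately have "int p dvd y - y'" "int p dvd w - w'"
      using pp t by (auto simp: prime_dvd_mult_iff)
    then show False using eqI range ne by blast
  qed
  then show ?thesis
    by (intro card_le_Suc0_iff_eq[THEN iffD2, simplified, unfolded One_nat_def[symmetric]] )
      auto
qed

text \<open>
  Fix \<open>t \<noteq> 0\<close> and join a point of the affine plane over the field of \<open>p\<close> elements to a coefficient
  vector when it lies on the corresponding line with right-hand side \<open>t\<close>. A line has \<open>p\<close> points and
  two lines share at most one, so two sets of points and of lines whose sizes have a product above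
  \<open>p\<^sup>3\<close> must be incident somewhere.
\<close>
lemma sums_of_two_products_cover:
  fixes X :: "int set"
  assumes p: "prime p" and X: "X \<subseteq> {0..<int p}" "0 \<in> X" and big: "p ^ 3 < card (X - {0}) ^ 4"
  shows "\<exists>x\<in>X. \<exists>y\<in>X. \<exists>z\<in>X. \<exists>w\<in>X. [x * y + z * w = t] (mod int p)"
proof (cases "int p dvd t")
  case True
  then have "[0 * 0 + 0 * 0 = t] (mod int p)" by (simp add: cong_iff_dvd_diff)
  then show ?thesis using X(2) by blast
next
  case False
  let ?U = "{0..<int p} \<times> {0..<int p}"
  let ?P = "(X - {0}) \<times> (X - {0})"
  let ?R = "\<lambda>u v. [fst u * fst v + snd u * snd v = t] (mod int p)"
  have fin: "finite X" using X(1) finite_subset by blast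
  \<comment> \<open>Zero is removed from \<open>X\<close> so that every coefficient vector defines a genuine line.\<close>
  have nd: "\<not> int p dvd x" if "x \<in> X - {0}" for x
    using that X(1) zdvd_not_zless[of x "int p"] by force
  have "\<exists>u\<in>?P. \<exists>v\<in>?P. ?R u v"
  proof (rule ccontr)
    assume none: "\<not> (\<exists>u\<in>?P. \<exists>v\<in>?P. ?R u v)"
    have "card ?P * card ?P \<le> p ^ 3"
    proof (rule few_common_neighbours_bound[where U = ?U and R = ?R])
      show "card {u\<in>?U. ?R u v} = p" if "v \<in> ?P" for v
        using that nd by (intro card_points_on_line_mod_prime[OF p]) auto
      show "card {u\<in>?U. ?R u v \<and> ?R u v'} \<le> 1" if "v \<in> ?P" "v' \<in> ?P" "v \<noteq> v'" for v v'
        using that X(1) by (intro card_common_points_of_lines_mod_prime_le[OF p False]) (auto simp: prod_eq_iff)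
    qed (use X(1) fin none in \<open>auto simp: power2_eq_square\<close>)
    moreover have "card ?P * card ?P = card (X - {0}) ^ 4"
      by (simp add: power4_eq_xxxx card_cartesian_product)
    ultimately show False using big by simp
  qed
  then show ?thesis by auto
qed

section \<open>Values of 0-1 polynomials modulo a prime\<close>

fun zero_one_polys :: "nat \<Rightarrow> int poly set" where
  "zero_one_polys 0 = {0}"
| "zero_one_polys (Suc n) = (\<lambda>(e, f). pCons e f) ` ({0, 1} \<times> zero_one_polys n)"

lemma zero_in_zero_one_polys: "0 \<in> zero_one_polys n"
  by (induction n) (auto intro!: image_eqI[of _ _ "(0, 0)"])

lemma card_zero_one_polys: "finite (zero_one_polys n) \<and> card (zero_one_polys n) = 2 ^ n"
proof (induction n)
  case (Suc n)
  have "inj_on (\<lambda>(e, f). pCons e f) ({0, 1} \<times> zero_one_polys n)"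
    by (auto simp: inj_on_def)
  then show ?case
    using Suc by (simp only: zero_one_polys.simps) (simp add: card_image card_cartesian_product)
qed simp

lemma degree_zero_one_polys: "f \<in> zero_one_polys n \<Longrightarrow> Polynomial.degree f \<le> n"
proof (induction n arbitrary: f)
  case (Suc n)
  then obtain e g where "f = pCons e g" "g \<in> zero_one_polys n" by auto
  then show ?case using Suc.IH by (auto simp: degree_pCons_eq_if)
qed simp

lemma coeff_zero_one_polys: "f \<in> zero_one_polys n \<Longrightarrow> Polynomial.coeff f i \<in> {0, 1}"
proof (induction n arbitrary: f i)
  case (Suc n)
  then obtain e g where "f = pCons e g" "g \<in> zero_one_polys n" "e \<in> {0, 1}" by auto
  then show ?case using Suc.IH by (cases i) auto
qed simp

text \<open>
  The argument is the one over a field: a root modulo \<open>p\<close> splits off a linear factor, up to a constant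
  divisible by \<open>p\<close>. The hypothesis on the coefficient says that \<open>f\<close> does not vanish modulo \<open>p\<close>.
\<close>
lemma card_roots_mod_prime_le:
  fixes f :: "int poly"
  assumes p: "prime p" and f: "\<not> int p dvd Polynomial.coeff f i" and "Polynomial.degree f \<le> n"
  shows "card {x \<in> {0..<int p}. int p dvd poly f x} \<le> n"
  using assms(2-)
proof (induction n arbitrary: f i)
  case 0
  then obtain c where [simp]: "f = [:c:]" using degree_eq_zeroE by auto
  have "\<not> int p dvd c" using 0 by (cases i) auto
  then show ?case by simp
next
  case (Suc n)
  show ?case
  proof (cases "{x \<in> {0..<int p}. int p dvd poly f x} = {}")
    case False
    then obtain a where a: "0 \<le> a" "a < int p" "int p dvd poly f a" by auto
    define g where "g = synthetic_div f a"
    have f_eq: "[:- a, 1:] * g + [:poly f a:] = f"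
      unfolding g_def by (rule synthetic_div_correct')
    have "\<exists>j. \<not> int p dvd Polynomial.coeff g j"
    proof (rule ccontr)
      assume "\<not> ?thesis"
      then have "int p dvd Polynomial.coeff ([:- a, 1:] * g + [:poly f a:]) i"
        using a by (cases i) auto
      then show False using Suc.prems by (simp only: f_eq)
    qed
    then obtain j where "\<not> int p dvd Polynomial.coeff g j" ..
    moreover have "Polynomial.degree g \<le> n"
      using Suc.prems unfolding g_def by (simp add: degree_synthetic_div)
    ultimately have IH: "card {x \<in> {0..<int p}. int p dvd poly g x} \<le> n"
      by (rule Suc.IH)
    have "{x \<in> {0..<int p}. int p dvd poly f x} \<subseteq> insert a {x \<in> {0..<int p}. int p dvd poly g x}"
    proof (rule subsetI, rule ccontr)
      fix x assume "x \<in> {x \<in> {0..<int p}. int p dvd poly f x}"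
        and n: "x \<notin> insert a {x \<in> {0..<int p}. int p dvd poly g x}"
      then have x: "0 \<le> x" "x < int p" "int p dvd poly f x" "\<not> int p dvd poly g x" by auto
      have "poly f x = (x - a) * poly g x + poly f a"
        by (subst (1) f_eq[symmetric]) (simp add: algebra_simps)
      then have "int p dvd (x - a) * poly g x"
        using x(3) a(3) by (simp add: dvd_add_left_iff)
      then have "int p dvd x - a"
        using x(4) p by (simp add: prime_dvd_mult_iff)
      then have "x = a"
        using x a by (auto simp flip: cong_iff_dvd_diff simp: cong_def)
      then show False using n by simp
    qed
    then have "card {x \<in> {0..<int p}. int p dvd poly f x} \<le>
        card (insert a {x \<in> {0..<int p}. int p dvd poly g x})"
      by (intro card_mono finite.insertI finite_subset[of "{x \<in> {0..<int p}. int p dvd poly g x}" "{0..<int p}"])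
        auto
    also have "\<dots> \<le> Suc n" using IH by (intro card_insert_le_m1) auto
    finally show ?thesis .
  qed (metis card.empty le0)
qed

text \<open>
  This is the Cauchy-Schwarz inequality for the fibre sizes of \<open>h\<close>: a map with few collisions has a
  large image.
\<close>
lemma card_sq_le_card_image_times_collisions:
  assumes "finite W"
  shows "(card W)\<^sup>2 \<le> card (h ` W) * card {(f, g). f \<in> W \<and> g \<in> W \<and> h f = h g}"
proof -
  define r where "r x = card {f \<in> W. h f = x}" for x
  have W: "card W = (\<Sum>x\<in>h ` W. r x)"
    unfolding r_def using assms
    by (subst card_UN_disjoint[symmetric]) (auto intro!: arg_cong[of _ _ card])
  have "{(f, g). f \<in> W \<and> g \<in> W \<and> h f = h g} =
      (\<Union>x\<in>h ` W. {f \<in> W. h f = x} \<times> {f \<in> W. h f = x})"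
    by auto
  also have "card \<dots> = (\<Sum>x\<in>h ` W. (r x)\<^sup>2)"
    unfolding r_def using assms
    by (subst card_UN_disjoint) (auto simp: card_cartesian_product power2_eq_square)
  finally have E: "card {(f, g). f \<in> W \<and> g \<in> W \<and> h f = h g} = (\<Sum>x\<in>h ` W. (r x)\<^sup>2)" .
  have "(\<Sum>x\<in>h ` W. 1 * real (r x))\<^sup>2 \<le> (\<Sum>x\<in>h ` W. 1\<^sup>2) * (\<Sum>x\<in>h ` W. (real (r x))\<^sup>2)"
    by (rule Cauchy_Schwarz_ineq_sum)
  then have "real ((\<Sum>x\<in>h ` W. r x)\<^sup>2) \<le> real (card (h ` W) * (\<Sum>x\<in>h ` W. (r x)\<^sup>2))"
    by simp
  then show ?thesis unfolding W E by (simp only: of_nat_le_iff)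
qed

text \<open>
  Each polynomial collides with itself at all \<open>p\<close> points, and a pair of distinct polynomials collides
  only at the roots of their difference, which has a coefficient \<open>1\<close> or \<open>- 1\<close> and therefore remains
  nonzero modulo every prime.
\<close>
lemma sum_collisions_le:
  assumes p: "prime p"
  shows "(\<Sum>x\<in>{0..<int p}. card {(f, g). f \<in> zero_one_polys n \<and> g \<in> zero_one_polys n \<and>
        poly f x mod int p = poly g x mod int p}) \<le> 2 ^ n * p + (2 ^ n)\<^sup>2 * n"
proof -
  let ?W = "zero_one_polys n" and ?F = "{0..<int p}"
  let ?E = "\<lambda>fg x. poly (fst fg) x mod int p = poly (snd fg) x mod int p"
  have fin: "finite ?W" and cW: "card ?W = 2 ^ n" using card_zero_one_polys by auto
  have "(\<Sum>x\<in>?F. card {(f, g). f \<in> ?W \<and> g \<in> ?W \<and> poly f x mod int p = poly g x mod int p}) =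
      (\<Sum>x\<in>?F. \<Sum>fg\<in>?W \<times> ?W. of_bool (?E fg x))"
    using fin by (intro sum.cong refl)
       (auto simp: sum.If_cases of_bool_def intro!: arg_cong[of _ _ card])
  also have "\<dots> = (\<Sum>fg\<in>?W \<times> ?W. \<Sum>x\<in>?F. of_bool (?E fg x))" by (rule sum.swap)
  also have "\<dots> = (\<Sum>fg\<in>?W \<times> ?W. card {x\<in>?F. ?E fg x})"
    by (intro sum.cong refl) (auto simp: sum.If_cases of_bool_def Int_def)
  also have "\<dots> \<le> (\<Sum>(f, g)\<in>?W \<times> ?W. (if g = f then p else 0) + n)"
  proof (intro sum_mono, clarify)
    fix f g assume fg: "f \<in> ?W" "g \<in> ?W"
    show "card {x\<in>?F. ?E (f, g) x} \<le> (if g = f then p else 0) + n"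
    proof (cases "g = f")
      case False
      then obtain i where i: "Polynomial.coeff f i \<noteq> Polynomial.coeff g i"
        using poly_eqI by blast
      have "Polynomial.coeff (f - g) i \<in> {1, -1}"
        using i coeff_zero_one_polys[OF fg(1), of i] coeff_zero_one_polys[OF fg(2), of i] by auto
      then have "\<not> int p dvd Polynomial.coeff (f - g) i"
        using prime_gt_1_nat[OF p] by auto
      then have "card {x \<in> ?F. int p dvd poly (f - g) x} \<le> n"
        using degree_zero_one_polys[OF fg(1)] degree_zero_one_polys[OF fg(2)]
        by (intro card_roots_mod_prime_le[OF p]) (auto intro: degree_diff_le)
      then show ?thesis using False by (simp add: mod_eq_dvd_iff)
    next
      case True
      have "card {x\<in>?F. ?E (f, g) x} \<le> card ?F" by (intro card_mono) auto
      then show ?thesis using True by simp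
    qed
  qed
  also have "\<dots> = (\<Sum>f\<in>?W. \<Sum>g\<in>?W. (if g = f then p else 0) + n)"
    by (rule sum.cartesian_product[symmetric])
  also have "\<dots> = 2 ^ n * p + (2 ^ n)\<^sup>2 * n"
    using fin by (simp add: sum.distrib cW power2_eq_square algebra_simps)
  finally show ?thesis .
qed

definition horner_values :: "nat \<Rightarrow> nat \<Rightarrow> int \<Rightarrow> int set" where
  "horner_values p n x = (\<lambda>f. poly f x mod int p) ` zero_one_polys n"

text \<open>
  Markov's inequality for the number of collisions: as \<open>2\<^sup>n \<le> p\<close>, its average over the points is at
  most \<open>2\<^sup>n * (1 + n)\<close>, and few values force at least \<open>K\<close> times as many.
\<close>
lemma few_bases_with_few_values:
  fixes K :: real
  assumes p: "prime p" and n: "2 ^ n \<le> p" and K: "0 < K"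
  shows "real (card {x \<in> {0..<int p}. real (card (horner_values p n x)) * (K * (1 + real n)) < 2 ^ n}) \<le> p / K"
proof -
  let ?W = "zero_one_polys n" and ?F = "{0..<int p}"
  let ?c = "\<lambda>x. card {(f, g). f \<in> ?W \<and> g \<in> ?W \<and> poly f x mod int p = poly g x mod int p}"
  let ?Bad = "{x \<in> ?F. real (card (horner_values p n x)) * (K * (1 + real n)) < 2 ^ n}"
  define N :: real where "N = 2 ^ n"
  have N: "0 < N" by (simp add: N_def)
  have c: "N * (K * (1 + real n)) \<le> real (?c x)" if x: "x \<in> ?Bad" for x
  proof -
    let ?v = "real (card (horner_values p n x))"
    have "(card ?W)\<^sup>2 \<le> card (horner_values p n x) * ?c x"
      unfolding horner_values_def
      using card_zero_one_polys by (intro card_sq_le_card_image_times_collisions) auto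
    then have "real ((card ?W)\<^sup>2) \<le> real (card (horner_values p n x) * ?c x)"
      by (simp only: of_nat_le_iff)
    then have sq: "N\<^sup>2 \<le> ?v * real (?c x)"
      using card_zero_one_polys[of n] by (simp add: N_def)
    have v: "?v * (K * (1 + real n)) < N" using x by (simp add: N_def)
    have "N * (N * (K * (1 + real n))) = N\<^sup>2 * (K * (1 + real n))" by (simp add: power2_eq_square)
    also have "\<dots> \<le> ?v * real (?c x) * (K * (1 + real n))"
      using sq K by (intro mult_right_mono) auto
    also have "\<dots> = ?v * (K * (1 + real n)) * real (?c x)" by (simp add: mult_ac)
    also have "\<dots> \<le> N * real (?c x)" using v by (intro mult_right_mono) auto
    finally show ?thesis using N by simp
  qed
  have "real (card ?Bad) * (N * (K * (1 + real n))) = (\<Sum>x\<in>?Bad. N * (K * (1 + real n)))" by simp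
  also have "\<dots> \<le> (\<Sum>x\<in>?Bad. real (?c x))" by (intro sum_mono c)
  also have "\<dots> \<le> (\<Sum>x\<in>?F. real (?c x))" by (intro sum_mono2) auto
  also have "\<dots> \<le> real (2 ^ n * p + (2 ^ n)\<^sup>2 * n)"
    using sum_collisions_le[OF p, of n] by (simp only: of_nat_sum[symmetric] of_nat_le_iff)
  also have "\<dots> = N * p + N * N * n" by (simp add: N_def power2_eq_square)
  also have "\<dots> \<le> N * p + N * p * n"
  proof -
    have "N \<le> real p"
      using n unfolding N_def by (metis of_nat_le_iff of_nat_numeral of_nat_power)
    then show ?thesis using N by (intro add_left_mono mult_right_mono mult_left_mono) auto
  qed
  also have "\<dots> = p / K * (N * (K * (1 + real n)))"
    using K by (simp add: field_simps)
  finally show ?thesis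
    using N K by (simp add: mult_le_cancel_right add_pos_nonneg pos_le_divide_eq)
qed

section \<open>Covering the Lie algebra\<close>

lemma odd_prime_not_dvd_4:
  assumes "prime p" "p \<noteq> 2"
  shows "\<not> int p dvd 4"
proof
  assume "int p dvd 4"
  then have "p dvd 4" by (metis int_dvd_int_iff of_nat_numeral)
  then have "p dvd 2 ^ 2" by simp
  then have "p dvd 2" using assms(1) prime_dvd_power by blast
  then show False using assms by (metis primes_dvd_imp_eq two_is_prime_nat)
qed

text \<open>
  For \<open>A\<close> and \<open>B\<close> in the coordinates of \<open>sl2_mat\<close>, this is the determinant of the coordinate vectors of
  \<open>A\<close>, \<open>B\<close> and \<open>[A, B]\<close>. It is also minus the determinant of the matrix \<open>[A, B]\<close>.
\<close>
definition bracket_disc :: "int \<times> int \<times> int \<Rightarrow> int \<times> int \<times> int \<Rightarrow> int" where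
  "bracket_disc = (\<lambda>(a, b, c) (d, e, f). (b * f - c * e)\<^sup>2 + 4 * (a * e - b * d) * (c * d - a * f))"

text \<open>The eigenvalue of \<open>(ad A)\<^sup>2\<close> on the orthogonal complement of \<open>A\<close> under the trace form.\<close>
definition ad_sq_eigenvalue :: "int \<times> int \<times> int \<Rightarrow> int" where
  "ad_sq_eigenvalue = (\<lambda>(a, b, c). 4 * (a\<^sup>2 + b * c))"

text \<open>
  With \<open>m = 4 * n - 2\<close>, the Horner step puts \<open>x C\<close> into the \<open>m\<close>-th power for all \<open>x\<close> in the set of values.
  Two brackets \<open>[x C, [A, y C]]\<close> give an arbitrary multiple of \<open>A\<close> with cost \<open>4 * m + 2\<close>. A multiple of
  \<open>B\<close> has the same cost, and one of \<open>C\<close> costs one more. The total for a combination of the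
  three is \<open>12 * m + 7 = 48 * n - 17\<close>.
\<close>
lemma sl2_Fp_covered:
  fixes a b c d e f :: int
  assumes p: "prime p" "p \<noteq> 2" and n: "0 < n"
    and disc: "\<not> int p dvd bracket_disc (a, b, c) (d, e, f)"
    and X: "p ^ 3 < card (horner_values p n (ad_sq_eigenvalue (a, b, c)) - {0}) ^ 4"
    and S: "\<zero>\<^bsub>sl2_Fp p\<^esub> \<in> S" "S \<subseteq> carrier (sl2_Fp p)"
      "sl2_mat p a b c \<in> S" "sl2_mat p d e f \<in> S"
  shows "carrier (sl2_Fp p) \<subseteq> lie_power (sl2_Fp p) S (48 * n - 17)"
proof -
  interpret L: lie_algebra "residue_ring (int p)" "sl2_Fp p"
    by (rule lie_algebra_sl2[OF field_residue_ring[OF p(1)]])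
  note add = sl2_mat_add[OF p(1)] and br = sl2_mat_bracket[OF p(1)] and
    eqI = sl2_mat_eq_iff[OF p(1), THEN iffD2]
  define m where "m = 4 * n - 2"
  have m: "0 < m" using n by (simp add: m_def)
  define t where "t = ad_sq_eigenvalue (a, b, c)"
  define \<delta> where "\<delta> = bracket_disc (a, b, c) (d, e, f)"
  define u where "u = b * f - c * e"
  define v where "v = 2 * (a * e - b * d)"
  define w where "w = 2 * (c * d - a * f)"
  note defs = t_def \<delta>_def u_def v_def w_def bracket_disc_def ad_sq_eigenvalue_def
  let ?S = "lie_power (sl2_Fp p) S"
  let ?A = "\<lambda>x. sl2_mat p (x * a) (x * b) (x * c)"
  let ?B = "\<lambda>x. sl2_mat p (x * d) (x * e) (x * f)"
  let ?C = "\<lambda>x. sl2_mat p (x * u) (x * v) (x * w)"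
  have mono: "x \<in> ?S j" if "x \<in> ?S i" "0 < i" "i \<le> j" for x i j
    using L.lie_power_mono[OF S(1,2) that(2,3)] that(1) by blast
  have A1: "sl2_mat p a b c \<in> ?S 1" and B1: "sl2_mat p d e f \<in> ?S 1"
    using S by (simp_all add: lie_power_1)
  have C2: "?C \<epsilon> \<in> ?S 2" if "\<epsilon> \<in> {0, 1}" for \<epsilon>
  proof (cases "\<epsilon> = 0")
    case True
    have "\<zero>\<^bsub>sl2_Fp p\<^esub> \<in> ?S 1" using S by (simp add: lie_power_1)
    then show ?thesis using True mono[of _ 1 2] by (simp add: sl2_mat_zero[OF p(1)])
  next
    case False
    then show ?thesis
      using lie_power_bracketI[OF A1 B1] that by (simp add: br defs numeral_2_eq_2)
  qed
  \<comment> \<open>\<open>C\<close> is an eigenvector of \<open>(ad A)\<^sup>2\<close>.\<close>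
  have ad_A: "sl2_mat p a b c \<otimes>\<^bsub>sl2_Fp p\<^esub> (sl2_mat p a b c \<otimes>\<^bsub>sl2_Fp p\<^esub> ?C x) = ?C (t * x)" for x
    unfolding br by (rule arg_cong3[where f = "sl2_mat p"]; simp add: defs power2_eq_square algebra_simps)
  have horner: "?C (poly g t) \<in> ?S (4 * k + 2)" if "g \<in> zero_one_polys (Suc k)" for g k
    using that
  proof (induction k arbitrary: g)
    case 0
    then have "poly g t \<in> {0, 1}" by auto
    from C2[OF this] show ?case by (simp add: numeral_2_eq_2)
  next
    case (Suc k)
    then obtain \<epsilon> h where g: "g = pCons \<epsilon> h" and \<epsilon>: "\<epsilon> \<in> {0, 1}" and h: "h \<in> zero_one_polys (Suc k)"
      by (subst (asm) zero_one_polys.simps) auto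
    have "?C (t * poly h t) \<in> ?S (1 + (1 + (4 * k + 2)))"
      unfolding ad_A[symmetric] using Suc.IH[OF h] A1 by (intro lie_power_bracketI) auto
    then have "?C (t * poly h t) \<oplus>\<^bsub>sl2_Fp p\<^esub> ?C \<epsilon> \<in> ?S (1 + (1 + (4 * k + 2)) + 2)"
      using C2[OF \<epsilon>] by (intro lie_power_addI) auto
    moreover have "?C (t * poly h t) \<oplus>\<^bsub>sl2_Fp p\<^esub> ?C \<epsilon> = ?C (poly g t)"
      by (simp add: add g algebra_simps)
    moreover have "1 + (1 + (4 * k + 2)) + 2 = 4 * Suc k + 2" by simp
    ultimately show ?case by (simp only:)
  qed
  define X where "X = horner_values p n t"
  have C_X: "?C x \<in> ?S m" if x: "x \<in> X" for x
  proof -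
    obtain g where g: "g \<in> zero_one_polys n" "x = poly g t mod int p"
      using x unfolding X_def horner_values_def by blast
    obtain k where k: "n = Suc k" using n gr0_conv_Suc by blast
    have "?C x = ?C (poly g t)" by (rule eqI) (simp add: g(2) cong_def mod_simps)
    then show ?thesis using horner[of g k] g(1) k by (simp add: m_def)
  qed
  have cover: "\<exists>x\<in>X. \<exists>y\<in>X. \<exists>z\<in>X. \<exists>w\<in>X. [- 4 * \<delta> * (x * y + z * w) = s] (mod int p)" for s
  proof -
    have "\<not> int p dvd - 4 * \<delta>"
      using disc odd_prime_not_dvd_4[OF p] p(1) by (simp add: \<delta>_def prime_dvd_mult_iff)
    then obtain i where i: "[- 4 * \<delta> * i = 1] (mod int p)" using inverse_mod_prime[OF p(1)] by blast
    have "\<exists>x\<in>X. \<exists>y\<in>X. \<exists>z\<in>X. \<exists>w\<in>X. [x * y + z * w = i * s] (mod int p)"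
    proof (rule sums_of_two_products_cover[OF p(1)])
      show "X \<subseteq> {0..<int p}" using prime_gt_0_nat[OF p(1)] by (auto simp: X_def horner_values_def)
      show "0 \<in> X" using zero_in_zero_one_polys unfolding X_def horner_values_def
        by (intro image_eqI[of _ _ 0]) auto
    qed (use X in \<open>simp add: X_def t_def\<close>)
    moreover have "[- 4 * \<delta> * r = s] (mod int p)" if "[r = i * s] (mod int p)" for r
    proof -
      have "[- 4 * \<delta> * r = - 4 * \<delta> * (i * s)] (mod int p)" using that by (intro cong_mult) auto
      also have "- 4 * \<delta> * (i * s) = (- 4 * \<delta> * i) * s" by simp
      also have "[(- 4 * \<delta> * i) * s = 1 * s] (mod int p)" using i by (intro cong_mult) auto
      finally show ?thesis by simp
    qed
    ultimately show ?thesis by meson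
  qed
  \<comment> \<open>The bracket of a multiple of \<open>C\<close> with one of \<open>[A, C]\<close> or \<open>[B, C]\<close> multiplies the coefficients.\<close>
  have A_prod: "?C x \<otimes>\<^bsub>sl2_Fp p\<^esub> (sl2_mat p a b c \<otimes>\<^bsub>sl2_Fp p\<^esub> ?C y) = ?A (- 4 * \<delta> * (x * y))" for x y
    unfolding br by (rule arg_cong3[where f = "sl2_mat p"]; simp add: defs power2_eq_square algebra_simps)
  have B_prod: "?C x \<otimes>\<^bsub>sl2_Fp p\<^esub> (sl2_mat p d e f \<otimes>\<^bsub>sl2_Fp p\<^esub> ?C y) = ?B (- 4 * \<delta> * (x * y))" for x y
    unfolding br by (rule arg_cong3[where f = "sl2_mat p"]; simp add: defs power2_eq_square algebra_simps)
  have A_all: "?A s \<in> ?S (4 * m + 2)" for s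
  proof -
    obtain x y z r where *: "x \<in> X" "y \<in> X" "z \<in> X" "r \<in> X"
      and s: "[- 4 * \<delta> * (x * y + z * r) = s] (mod int p)" using cover[of s] by blast
    have "?A (- 4 * \<delta> * (x * y)) \<oplus>\<^bsub>sl2_Fp p\<^esub> ?A (- 4 * \<delta> * (z * r)) \<in> ?S (m + (1 + m) + (m + (1 + m)))"
      unfolding A_prod[symmetric] using * m
      by (intro lie_power_addI lie_power_bracketI C_X A1) auto
    moreover have "?A (- 4 * \<delta> * (x * y)) \<oplus>\<^bsub>sl2_Fp p\<^esub> ?A (- 4 * \<delta> * (z * r)) = ?A (- 4 * \<delta> * (x * y + z * r))"
      by (simp add: add algebra_simps)
    moreover have "?A (- 4 * \<delta> * (x * y + z * r)) = ?A s"
      using s by (intro eqI conjI cong_mult) auto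
    moreover have "m + (1 + m) + (m + (1 + m)) = 4 * m + 2" by simp
    ultimately show ?thesis by (simp only:)
  qed
  have B_all: "?B s \<in> ?S (4 * m + 2)" for s
  proof -
    obtain x y z r where *: "x \<in> X" "y \<in> X" "z \<in> X" "r \<in> X"
      and s: "[- 4 * \<delta> * (x * y + z * r) = s] (mod int p)" using cover[of s] by blast
    have "?B (- 4 * \<delta> * (x * y)) \<oplus>\<^bsub>sl2_Fp p\<^esub> ?B (- 4 * \<delta> * (z * r)) \<in> ?S (m + (1 + m) + (m + (1 + m)))"
      unfolding B_prod[symmetric] using * m
      by (intro lie_power_addI lie_power_bracketI C_X B1) auto
    moreover have "?B (- 4 * \<delta> * (x * y)) \<oplus>\<^bsub>sl2_Fp p\<^esub> ?B (- 4 * \<delta> * (z * r)) = ?B (- 4 * \<delta> * (x * y + z * r))"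
      by (simp add: add algebra_simps)
    moreover have "?B (- 4 * \<delta> * (x * y + z * r)) = ?B s"
      using s by (intro eqI conjI cong_mult) auto
    moreover have "m + (1 + m) + (m + (1 + m)) = 4 * m + 2" by simp
    ultimately show ?thesis by (simp only:)
  qed
  have C_all: "?C s \<in> ?S (1 + (4 * m + 2))" for s
  proof -
    have "?C s = sl2_mat p a b c \<otimes>\<^bsub>sl2_Fp p\<^esub> ?B s"
      unfolding br by (rule arg_cong3[where f = "sl2_mat p"]; simp add: defs algebra_simps)
    then show ?thesis using lie_power_bracketI[OF A1 B_all] by simp
  qed
  show ?thesis
  proof
    fix Z assume "Z \<in> carrier (sl2_Fp p)"
    then obtain x y z where Z: "Z = sl2_mat p x y z" by (auto simp: carrier_sl2_Fp[OF p(1)])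
    obtain i where i: "[\<delta> * i = 1] (mod int p)"
      using inverse_mod_prime[OF p(1) disc] by (auto simp: \<delta>_def)
    \<comment> \<open>Cramer's rule: these are the determinants obtained by putting \<open>Z\<close> in place of \<open>A\<close>, \<open>B\<close> or \<open>C\<close>;
      the determinant of the system itself is \<open>\<delta>\<close>.\<close>
    define r1 where "r1 = x * (e * w - f * v) - y * (d * w - f * u) + z * (d * v - e * u)"
    define r2 where "r2 = a * (y * w - z * v) - b * (x * w - z * u) + c * (x * v - y * u)"
    define r3 where "r3 = a * (e * z - f * y) - b * (d * z - f * x) + c * (d * y - e * x)"
    have red: "sl2_mat p (\<delta> * i * x) (\<delta> * i * y) (\<delta> * i * z) = sl2_mat p x y z"
      using cong_mult[OF i cong_refl] by (intro eqI conjI) (metis mult_1)+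
    have "?A (i * r1) \<oplus>\<^bsub>sl2_Fp p\<^esub> ?B (i * r2) \<oplus>\<^bsub>sl2_Fp p\<^esub> ?C (i * r3) =
        sl2_mat p (\<delta> * i * x) (\<delta> * i * y) (\<delta> * i * z)"
      unfolding add
      by (rule arg_cong3[where f = "sl2_mat p"];
          simp add: r1_def r2_def r3_def defs power2_eq_square algebra_simps)
    then have "Z = ?A (i * r1) \<oplus>\<^bsub>sl2_Fp p\<^esub> ?B (i * r2) \<oplus>\<^bsub>sl2_Fp p\<^esub> ?C (i * r3)"
      using red Z by simp
    moreover have "\<dots> \<in> ?S (4 * m + 2 + (4 * m + 2) + (1 + (4 * m + 2)))"
      using A_all B_all C_all by (intro lie_power_addI) auto
    moreover have "4 * m + 2 + (4 * m + 2) + (1 + (4 * m + 2)) = 48 * n - 17"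
      using n by (simp add: m_def)
    ultimately show "Z \<in> ?S (48 * n - 17)" by simp
  qed
qed

section \<open>Counting degenerate pairs\<close>

lemma horner_values_mod: "horner_values p n (x mod int p) = horner_values p n x"
proof -
  have "[poly f (x mod int p) = poly f x] (mod int p)" for f
    by (induction f) (auto simp: cong_def intro!: cong_add[unfolded cong_def] cong_mult[unfolded cong_def])
  then show ?thesis by (simp add: horner_values_def cong_def)
qed

lemma card_le_by_fibres:
  assumes "finite S" "finite F" "\<And>s. s \<in> S \<Longrightarrow> card {x \<in> F. Q s x} \<le> m"
  shows "card {(s, x) \<in> S \<times> F. Q s x} \<le> card S * m"
proof -
  have "{(s, x) \<in> S \<times> F. Q s x} = Sigma S (\<lambda>s. {x \<in> F. Q s x})" by auto
  then have "card {(s, x) \<in> S \<times> F. Q s x} = (\<Sum>s\<in>S. card {x \<in> F. Q s x})"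
    using assms(1,2) by (simp only:) (rule card_SigmaI, auto)
  also have "\<dots> \<le> card S * m" using sum_bounded_above[of S "\<lambda>s. card {x \<in> F. Q s x}" m] assms(3) by simp
  finally show ?thesis .
qed

text \<open>
  For \<open>b \<noteq> 0\<close> the eigenvalue is an injective function of \<open>c\<close>, so each exceptional value is taken once
  for each \<open>a\<close> and \<open>b\<close>. The matrices with \<open>b = 0\<close> are simply counted as exceptional.
\<close>
lemma card_ad_sq_eigenvalue_in_le:
  assumes p: "prime p" "p \<noteq> 2" and L: "finite L"
  shows "card {(a, b, c) \<in> {0..<int p} \<times> {0..<int p} \<times> {0..<int p}.
      b = 0 \<or> ad_sq_eigenvalue (a, b, c) mod int p \<in> L} \<le> p * (p * (1 + card L))"
proof -
  let ?F = "{0..<int p}"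
  have 1: "card {(b, c) \<in> ?F \<times> ?F. b = 0 \<or> ad_sq_eigenvalue (a, b, c) mod int p \<in> L} \<le> p * (1 + card L)"
    for a
  proof -
    have "{(b, c) \<in> ?F \<times> ?F. b = 0 \<or> ad_sq_eigenvalue (a, b, c) mod int p \<in> L} \<subseteq>
       {0} \<times> ?F \<union> {(b, c) \<in> (?F - {0}) \<times> ?F. ad_sq_eigenvalue (a, b, c) mod int p \<in> L}"
      by auto
    then have "card {(b, c) \<in> ?F \<times> ?F. b = 0 \<or> ad_sq_eigenvalue (a, b, c) mod int p \<in> L} \<le>
       card ({0} \<times> ?F \<union> {(b, c) \<in> (?F - {0}) \<times> ?F. ad_sq_eigenvalue (a, b, c) mod int p \<in> L})"
      by (rule card_mono[rotated]) (auto intro: finite_subset[of _ "?F \<times> ?F"])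
    also have "\<dots> \<le> card ({0::int} \<times> ?F) +
         card {(b, c) \<in> (?F - {0}) \<times> ?F. ad_sq_eigenvalue (a, b, c) mod int p \<in> L}"
      by (rule card_Un_le)
    also have "card {(b, c) \<in> (?F - {0}) \<times> ?F. ad_sq_eigenvalue (a, b, c) mod int p \<in> L} \<le> card (?F - {0}) * card L"
    proof (rule card_le_by_fibres)
      fix b assume b: "b \<in> ?F - {0}"
      have "\<not> int p dvd b" using b zdvd_not_zless[of b "int p"] by force
      then have nd: "\<not> int p dvd 4 * b"
        using odd_prime_not_dvd_4[OF p] p(1) by (simp add: prime_dvd_mult_iff)
      have "inj_on (\<lambda>c. ad_sq_eigenvalue (a, b, c) mod int p) ?F"
      proof (rule inj_onI)
        fix c c' assume c: "c \<in> ?F" "c' \<in> ?F"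
          and eq: "ad_sq_eigenvalue (a, b, c) mod int p = ad_sq_eigenvalue (a, b, c') mod int p"
        have "ad_sq_eigenvalue (a, b, c) - ad_sq_eigenvalue (a, b, c') = 4 * b * (c - c')"
          by (simp add: ad_sq_eigenvalue_def algebra_simps)
        then have "int p dvd 4 * b * (c - c')" using eq by (simp add: mod_eq_dvd_iff)
        then have "int p dvd c - c'" using nd p(1) by (simp add: prime_dvd_mult_iff)
        then show "c = c'" using c by (auto simp flip: cong_iff_dvd_diff simp: cong_def)
      qed
      then show "card {c \<in> ?F. ad_sq_eigenvalue (a, b, c) mod int p \<in> L} \<le> card L"
        using L by (intro card_inj_on_le[where f = "\<lambda>c. ad_sq_eigenvalue (a, b, c) mod int p"])
          (auto intro: inj_on_subset)
    qed auto
    also have "\<dots> \<le> p * card L" by (intro mult_right_mono) (auto intro: order_trans[OF card_Diff1_le])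
    finally show ?thesis by (simp add: card_cartesian_product)
  qed
  let ?Q = "\<lambda>a bc. fst bc = 0 \<or> ad_sq_eigenvalue (a, bc) mod int p \<in> L"
  have "card {(a, bc) \<in> ?F \<times> (?F \<times> ?F). ?Q a bc} \<le> card ?F * (p * (1 + card L))"
  proof (rule card_le_by_fibres)
    fix a
    have "{bc \<in> ?F \<times> ?F. ?Q a bc} =
      {(b, c) \<in> ?F \<times> ?F. b = 0 \<or> ad_sq_eigenvalue (a, b, c) mod int p \<in> L}" by auto
    then show "card {bc \<in> ?F \<times> ?F. ?Q a bc} \<le> p * (1 + card L)" using 1 by simp
  qed auto
  moreover have "{(a, bc) \<in> ?F \<times> (?F \<times> ?F). ?Q a bc} =
      {(a, b, c) \<in> ?F \<times> ?F \<times> ?F. b = 0 \<or> ad_sq_eigenvalue (a, b, c) mod int p \<in> L}" by auto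
  ultimately show ?thesis by simp
qed

text \<open>As a polynomial in \<open>f\<close> the determinant is quadratic with leading coefficient \<open>b\<^sup>2\<close>.\<close>
lemma card_bracket_disc_zero_le:
  assumes p: "prime p" and b: "\<not> int p dvd b"
  shows "card {(d, e, f) \<in> {0..<int p} \<times> {0..<int p} \<times> {0..<int p}.
      int p dvd bracket_disc (a, b, c) (d, e, f)} \<le> p * (p * 2)"
proof -
  let ?F = "{0..<int p}"
  have 1: "card {f \<in> ?F. int p dvd bracket_disc (a, b, c) (d, e, f)} \<le> 2" for d e
  proof -
    define q where "q = [: (c * e)\<^sup>2 + 4 * (a * e - b * d) * (c * d),
       - 2 * b * c * e - 4 * (a * e - b * d) * a, b\<^sup>2 :]"
    have "bracket_disc (a, b, c) (d, e, f) = poly q f" for f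
      by (simp add: bracket_disc_def q_def power2_eq_square algebra_simps)
    moreover have "Polynomial.coeff q 2 = b\<^sup>2" "Polynomial.degree q \<le> 2"
      by (auto simp: q_def numeral_2_eq_2)
    moreover have "\<not> int p dvd b\<^sup>2" using p b by (simp add: prime_dvd_power_iff)
    ultimately show ?thesis using card_roots_mod_prime_le[OF p, of q 2 2] by simp
  qed
  have 2: "card {(e, f) \<in> ?F \<times> ?F. int p dvd bracket_disc (a, b, c) (d, e, f)} \<le> card ?F * 2" for d
    using 1 by (intro card_le_by_fibres) auto
  have "card {(d, ef) \<in> ?F \<times> (?F \<times> ?F). int p dvd bracket_disc (a, b, c) (d, ef)} \<le> card ?F * (p * 2)"
  proof (rule card_le_by_fibres)
    fix d
    have "{ef \<in> ?F \<times> ?F. int p dvd bracket_disc (a, b, c) (d, ef)} =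
      {(e, f) \<in> ?F \<times> ?F. int p dvd bracket_disc (a, b, c) (d, e, f)}" by auto
    then show "card {ef \<in> ?F \<times> ?F. int p dvd bracket_disc (a, b, c) (d, ef)} \<le> p * 2"
      using 2 by simp
  qed auto
  moreover have "{(d, ef) \<in> ?F \<times> (?F \<times> ?F). int p dvd bracket_disc (a, b, c) (d, ef)} =
    {(d, e, f) \<in> ?F \<times> ?F \<times> ?F. int p dvd bracket_disc (a, b, c) (d, e, f)}" by auto
  ultimately show ?thesis by simp
qed

text \<open>The set \<open>L\<close> collects the eigenvalues at which 0-1 polynomials take too few values.\<close>
definition degenerate_pair :: "nat \<Rightarrow> int set \<Rightarrow> int \<times> int \<times> int \<Rightarrow> int \<times> int \<times> int \<Rightarrow> bool" where
  "degenerate_pair p L A B \<longleftrightarrow>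
     ad_sq_eigenvalue A mod int p \<in> L \<or> int p dvd bracket_disc A B"

lemma card_degenerate_pairs_le:
  assumes p: "prime p" "p \<noteq> 2" and L: "finite L"
  defines "V \<equiv> {0..<int p} \<times> {0..<int p} \<times> {0..<int p}"
  shows "card {(A, B) \<in> V \<times> V. degenerate_pair p L A B} \<le> p ^ 5 * (3 + card L)"
proof -
  let ?A0 = "{(a, b, c) \<in> V. b = 0 \<or> ad_sq_eigenvalue (a, b, c) mod int p \<in> L}"
  have fin: "finite V" and cV: "card V = p ^ 3"
    by (simp_all add: V_def card_cartesian_product power3_eq_cube)
  have "{(A, B) \<in> V \<times> V. degenerate_pair p L A B} \<subseteq>
      ?A0 \<times> V \<union> {(A, B) \<in> (V - ?A0) \<times> V. int p dvd bracket_disc A B}"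
    by (auto simp: degenerate_pair_def)
  then have "card {(A, B) \<in> V \<times> V. degenerate_pair p L A B} \<le>
      card (?A0 \<times> V \<union> {(A, B) \<in> (V - ?A0) \<times> V. int p dvd bracket_disc A B})"
    using fin by (intro card_mono) (auto intro: finite_subset[of _ "V \<times> V"])
  also have "\<dots> \<le> card (?A0 \<times> V) + card {(A, B) \<in> (V - ?A0) \<times> V. int p dvd bracket_disc A B}"
    by (rule card_Un_le)
  also have "card {(A, B) \<in> (V - ?A0) \<times> V. int p dvd bracket_disc A B} \<le> card (V - ?A0) * (p * (p * 2))"
  proof (rule card_le_by_fibres)
    fix A assume A: "A \<in> V - ?A0"
    obtain a b c where A_eq: "A = (a, b, c)" by (cases A)
    have b: "b \<in> {0..<int p}" "b \<noteq> 0" using A unfolding A_eq V_def by auto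
    have "\<not> int p dvd b" using b zdvd_not_zless[of b "int p"] by force
    from card_bracket_disc_zero_le[OF p(1) this, of a c]
    show "card {B \<in> V. int p dvd bracket_disc A B} \<le> p * (p * 2)"
    proof (rule order_trans[rotated])
      show "card {B \<in> V. int p dvd bracket_disc A B} \<le> card {(d, e, f) \<in> {0..<int p} \<times> {0..<int p} \<times> {0..<int p}.
          int p dvd bracket_disc (a, b, c) (d, e, f)}"
        unfolding A_eq V_def[symmetric]
        by (intro card_mono finite_subset[OF _ fin]) auto
    qed
  qed (use fin in auto)
  also have "\<dots> \<le> p ^ 3 * (p * (p * 2))"
  proof (rule mult_right_mono)
    show "card (V - ?A0) \<le> p ^ 3" unfolding cV[symmetric] using fin by (intro card_mono) auto
  qed simp
  also have "card (?A0 \<times> V) \<le> p * (p * (1 + card L)) * p ^ 3"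
  proof -
    have "card ?A0 \<le> p * (p * (1 + card L))"
      using card_ad_sq_eigenvalue_in_le[OF p L] by (simp only: V_def)
    then show ?thesis unfolding card_cartesian_product cV by (rule mult_right_mono) simp
  qed
  also have "p * (p * (1 + card L)) * p ^ 3 + p ^ 3 * (p * (p * 2)) = p ^ 5 * (3 + card L)"
    by (simp add: eval_nat_numeral algebra_simps)
  finally show ?thesis by simp
qed

lemma bij_betw_sl2_mat:
  assumes p: "prime p"
  shows "bij_betw (\<lambda>(a, b, c). sl2_mat p a b c) ({0..<int p} \<times> {0..<int p} \<times> {0..<int p})
      (carrier (sl2_Fp p))"
  unfolding bij_betw_def
proof (intro conjI)
  show "inj_on (\<lambda>(a, b, c). sl2_mat p a b c) ({0..<int p} \<times> {0..<int p} \<times> {0..<int p})"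
    by (auto simp: inj_on_def sl2_mat_eq_iff[OF p] cong_def)
  have "sl2_mat p a b c = sl2_mat p (a mod int p) (b mod int p) (c mod int p)" for a b c
    by (simp add: sl2_mat_eq_iff[OF p] cong_def)
  then have V: "sl2_mat p a b c \<in> (\<lambda>(a, b, c). sl2_mat p a b c) ` ({0..<int p} \<times> {0..<int p} \<times> {0..<int p})" for a b c
    using prime_gt_0_nat[OF p] by (intro image_eqI[of _ _ "(a mod int p, b mod int p, c mod int p)"]) auto
  show "(\<lambda>(a, b, c). sl2_mat p a b c) ` ({0..<int p} \<times> {0..<int p} \<times> {0..<int p}) = carrier (sl2_Fp p)"
    unfolding carrier_sl2_Fp[OF p]
  proof (intro equalityI subsetI)
    fix x assume "x \<in> {sl2_mat p a b c |a b c. True}"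
    then obtain a b c where "x = sl2_mat p a b c" by auto
    then show "x \<in> (\<lambda>(a, b, c). sl2_mat p a b c) ` ({0..<int p} \<times> {0..<int p} \<times> {0..<int p})"
      using V by (simp only:)
  qed auto
qed

section \<open>Random pairs\<close>

lemma pair_pmf_of_set:
  assumes "finite A" "A \<noteq> {}" "finite B" "B \<noteq> {}"
  shows "pair_pmf (pmf_of_set A) (pmf_of_set B) = pmf_of_set (A \<times> B)"
proof (rule pmf_eqI)
  fix z :: "'a \<times> 'b"
  show "pmf (pair_pmf (pmf_of_set A) (pmf_of_set B)) z = pmf (pmf_of_set (A \<times> B)) z"
    using assms by (cases z) (auto simp: pmf_pair card_cartesian_product indicator_def)
qed

lemma prob_random_sl2_pair_ge:
  assumes p: "prime p" "p \<noteq> 2" and L: "finite L"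
    and E: "\<And>A B. \<not> degenerate_pair p L A B \<Longrightarrow>
       ((\<lambda>(a, b, c). sl2_mat p a b c) A, (\<lambda>(a, b, c). sl2_mat p a b c) B) \<in> E"
  shows "measure_pmf.prob
      (pair_pmf (pmf_of_set (carrier (sl2_Fp p))) (pmf_of_set (carrier (sl2_Fp p)))) E
      \<ge> 1 - (3 + real (card L)) / p"
proof -
  let ?V = "{0..<int p} \<times> {0..<int p} \<times> {0..<int p}" and ?G = "carrier (sl2_Fp p)"
  let ?m = "\<lambda>(a, b, c). sl2_mat p a b c"
  let ?bad = "{(A, B) \<in> ?V \<times> ?V. degenerate_pair p L A B}"
  have p0: "0 < p" using prime_gt_0_nat[OF p(1)] .
  note bij = bij_betw_sl2_mat[OF p(1)]
  have cG: "card ?G = p ^ 3"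
    using bij_betw_same_card[OF bij] by (simp add: card_cartesian_product power3_eq_cube)
  have fin: "finite ?G" and ne: "?G \<noteq> {}"
    using cG p0 by (auto intro: card_ge_0_finite)
  have "?G \<times> ?G - E \<subseteq> map_prod ?m ?m ` ?bad"
  proof
    fix Z assume Z: "Z \<in> ?G \<times> ?G - E"
    have G: "?G = ?m ` ?V" using bij by (simp add: bij_betw_def)
    obtain A B where AB: "A \<in> ?V" "B \<in> ?V" "Z = (?m A, ?m B)"
      using Z unfolding G by blast
    then have "degenerate_pair p L A B" using E[of A B] Z by auto
    then have "(A, B) \<in> ?bad" using AB by simp
    then show "Z \<in> map_prod ?m ?m ` ?bad" using AB(3) by (intro image_eqI[of _ _ "(A, B)"]) simp_all
  qed
  then have "card (?G \<times> ?G - E) \<le> card (map_prod ?m ?m ` ?bad)"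
    by (rule card_mono[rotated]) (intro finite_imageI finite_subset[of ?bad "?V \<times> ?V"], auto)
  also have "\<dots> \<le> card ?bad"
    by (rule card_image_le) (auto intro: finite_subset[of _ "?V \<times> ?V"])
  also have "\<dots> \<le> p ^ 5 * (3 + card L)" by (rule card_degenerate_pairs_le[OF p L])
  finally have "real (card (?G \<times> ?G - E)) \<le> real (p ^ 5 * (3 + card L))"
    by (simp only: of_nat_le_iff)
  then have bad: "real (card (?G \<times> ?G - E)) \<le> real p ^ 5 * (3 + real (card L))" by simp
  have "card (?G \<times> ?G) = card (?G \<times> ?G \<inter> E) + card (?G \<times> ?G - E)"
    using fin by (intro card_Int_Diff) auto
  then have "real (p ^ 6) = real (card (?G \<times> ?G \<inter> E)) + real (card (?G \<times> ?G - E))"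
    unfolding of_nat_add[symmetric] by (simp add: card_cartesian_product cG flip: power_add)
  then have good: "real p ^ 6 - real p ^ 5 * (3 + real (card L)) \<le> real (card (?G \<times> ?G \<inter> E))"
    using bad by simp
  have "measure_pmf.prob (pair_pmf (pmf_of_set ?G) (pmf_of_set ?G)) E =
      real (card (?G \<times> ?G \<inter> E)) / real p ^ 6"
    using fin ne
    by (simp add: pair_pmf_of_set measure_pmf_of_set card_cartesian_product cG flip: power_add)
  moreover have "1 - (3 + real (card L)) / p =
      (real p ^ 6 - real p ^ 5 * (3 + real (card L))) / real p ^ 6"
    using p0 by (simp add: field_simps eval_nat_numeral)
  ultimately show ?thesis using good p0 by (simp add: divide_right_mono)
qed

text \<open>
  Outside \<open>L\<close> the set of values has at least \<open>p / (2 * K * (1 + log 2 p))\<close> elements, which for large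
  \<open>p\<close> exceeds \<open>p powr (3 / 4)\<close> even after \<open>0\<close> is removed, as the covering argument needs.
\<close>
lemma lie_diam_sym_pair_le:
  fixes K :: real
  assumes p: "prime p" "p \<noteq> 2" and K: "0 < K"
    and n: "2 ^ n \<le> p" "p < 2 ^ (n + 1)"
    and large: "p powr (3 / 4) < p / (2 * K * (1 + log 2 p)) - 1"
    and L: "L = {x \<in> {0..<int p}. real (card (horner_values p n x)) * (K * (1 + real n)) < 2 ^ n}"
    and A: "\<not> degenerate_pair p L (a, b, c) (d, e, f)"
  shows "ereal_of_enat (lie_diam (residue_ring (int p)) (sl2_Fp p)
      (sym_pair (sl2_Fp p) (sl2_mat p a b c) (sl2_mat p d e f))) \<le> ereal (120 * ln p + 8)"
proof -
  interpret LA: lie_algebra "residue_ring (int p)" "sl2_Fp p"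
    by (rule lie_algebra_sl2[OF field_residue_ring[OF p(1)]])
  let ?S = "sym_pair (sl2_Fp p) (sl2_mat p a b c) (sl2_mat p d e f)"
  have p2: "2 \<le> p" using prime_ge_2_nat[OF p(1)] .
  have n0: "0 < n" using n p2 by (cases n) auto
  have mats: "sl2_mat p x y z \<in> carrier (sl2_Fp p)" for x y z
    by (auto simp: carrier_sl2_Fp[OF p(1)])
  have S: "?S \<subseteq> carrier (sl2_Fp p)"
    using mats by (simp add: sym_pair_def)
  define X where "X = horner_values p n (ad_sq_eigenvalue (a, b, c))"
  have nlog: "real n \<le> log 2 p"
    using n(1) by (rule le_log2_of_power)
  have "ad_sq_eigenvalue (a, b, c) mod int p \<notin> L" "\<not> int p dvd bracket_disc (a, b, c) (d, e, f)"
    using A by (auto simp: degenerate_pair_def)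
  then have "2 ^ n \<le> real (card X) * (K * (1 + real n))"
    using p2 by (simp add: L X_def horner_values_mod not_less)
  moreover have "real p \<le> 2 * 2 ^ n"
  proof -
    have "real p \<le> real (2 ^ (n + 1))" using n(2) by (simp only: of_nat_le_iff)
    then show ?thesis by simp
  qed
  ultimately have "p \<le> 2 * (real (card X) * (K * (1 + real n)))" by linarith
  also have "\<dots> = real (card X) * (2 * K * (1 + real n))" by simp
  also have "\<dots> \<le> real (card X) * (2 * K * (1 + log 2 p))"
    using nlog K by (intro mult_left_mono) auto
  finally have "p / (2 * K * (1 + log 2 p)) \<le> card X"
    using K p2 nlog by (subst pos_divide_le_eq) (auto intro!: mult_pos_pos)
  also have "real (card X) \<le> card (X - {0}) + 1"
    using card_Suc_Diff1[of X 0] card_zero_one_polys[of n]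
    by (cases "0 \<in> X") (auto simp: X_def horner_values_def)
  finally have "p powr (3 / 4) < card (X - {0})" using large by simp
  then have "(p powr (3 / 4)) ^ 4 < real (card (X - {0})) ^ 4"
    by (intro power_strict_mono) auto
  also have "(p powr (3 / 4)) ^ 4 = real p ^ 3"
    using p2 by (simp add: powr_powr flip: powr_numeral)
  finally have "real (p ^ 3) < real (card (X - {0}) ^ 4)" by simp
  then have big: "p ^ 3 < card (X - {0}) ^ 4" by (simp only: of_nat_less_iff)
  have "carrier (sl2_Fp p) \<subseteq> lie_power (sl2_Fp p) ?S (48 * n - 17)"
    using A big S by (intro sl2_Fp_covered[OF p n0, of a b c d e f])
      (auto simp: degenerate_pair_def X_def sym_pair_def)
  then have "lie_diam (residue_ring (int p)) (sl2_Fp p) ?S \<le> enat (48 * n - 17)"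
    using n0 by (intro LA.lie_diam_le[OF S]) auto
  then have "ereal_of_enat (lie_diam (residue_ring (int p)) (sl2_Fp p) ?S) \<le>
      ereal_of_enat (enat (48 * n - 17))"
    by (simp only: ereal_of_enat_le_iff)
  also have "\<dots> \<le> ereal (120 * ln p + 8)"
  proof -
    have "real (48 * n - 17) \<le> 48 * real n" by simp
    also have "real n * (2 / 3) \<le> real n * ln 2"
      using ln2_ge_two_thirds by (intro mult_left_mono) auto
    then have "48 * real n \<le> 72 * (real n * ln 2)" by simp
    also have "real n * ln 2 \<le> ln p"
      using nlog by (simp add: log_def field_simps)
    finally show ?thesis using p2 by simp
  qed
  finally show ?thesis .
qed

theorem theorem1p3:
  shows "\<exists>T :: nat set. T \<subseteq> {p. prime p} \<and> small_set T \<and>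
    (\<forall>\<epsilon>::real. \<epsilon> > 0 \<longrightarrow>
      (\<exists>C::real. \<forall>p::nat. prime p \<and> real p > C \<and> p \<notin> T \<longrightarrow>
        measure_pmf.prob
          (pair_pmf (pmf_of_set (carrier (sl2_Fp p))) (pmf_of_set (carrier (sl2_Fp p))))
          {(A, B). ereal_of_enat (lie_diam (residue_ring (int p)) (sl2_Fp p) (sym_pair (sl2_Fp p) A B))
                     \<le> ereal (120 * ln (real p) + 8)}
        \<ge> 1 - \<epsilon>))"
proof (rule exI[of _ "{}"], intro conjI allI impI)
  fix \<epsilon> :: real assume \<epsilon>: "0 < \<epsilon>"
  \<comment> \<open>The budget \<open>\<epsilon>\<close> is split evenly between the exceptional eigenvalues, of proportion \<open>1 / K\<close>, and the
    remaining degenerate pairs, of proportion \<open>3 / p\<close>.\<close>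
  define K where "K = 2 / \<epsilon>"
  have K: "0 < K" using \<epsilon> by (simp add: K_def)
  have "eventually (\<lambda>x::real. x powr (3 / 4) < x / (2 * K * (1 + log 2 x)) - 1) at_top"
    using K by real_asymp
  moreover have "eventually (\<lambda>x::real. 3 / x < \<epsilon> / 2) at_top"
    using \<epsilon> by real_asymp
  moreover have "eventually (\<lambda>x::real. 2 < x) at_top" by (rule eventually_gt_at_top)
  ultimately have "eventually (\<lambda>x::real. x powr (3 / 4) < x / (2 * K * (1 + log 2 x)) - 1 \<and>
      3 / x < \<epsilon> / 2 \<and> 2 < x) at_top"
    by eventually_elim simp
  then obtain C where C: "\<And>x. C \<le> x \<Longrightarrow> x powr (3 / 4) < x / (2 * K * (1 + log 2 x)) - 1 \<and>
      3 / x < \<epsilon> / 2 \<and> 2 < x"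
    unfolding eventually_at_top_linorder by blast
  show "\<exists>C::real. \<forall>p::nat. prime p \<and> real p > C \<and> p \<notin> {} \<longrightarrow>
        measure_pmf.prob
          (pair_pmf (pmf_of_set (carrier (sl2_Fp p))) (pmf_of_set (carrier (sl2_Fp p))))
          {(A, B). ereal_of_enat (lie_diam (residue_ring (int p)) (sl2_Fp p) (sym_pair (sl2_Fp p) A B))
                     \<le> ereal (120 * ln (real p) + 8)}
        \<ge> 1 - \<epsilon>"
  proof (intro exI[of _ C] allI impI, elim conjE)
    fix p :: nat assume p: "prime p" and pC: "C < real p"
    have large: "p powr (3 / 4) < p / (2 * K * (1 + log 2 p)) - 1" "3 / p < \<epsilon> / 2" "2 < real p"
      using C[of "real p"] pC by auto
    have p2: "p \<noteq> 2" using large(3) by auto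
    obtain n where n: "2 ^ n \<le> p" "p < 2 ^ (n + 1)"
      using ex_power_ivl1[of 2 p] prime_gt_0_nat[OF p] by auto
    define L where "L = {x \<in> {0..<int p}. real (card (horner_values p n x)) * (K * (1 + real n)) < 2 ^ n}"
    have "real (card L) \<le> p / K"
      unfolding L_def by (rule few_bases_with_few_values[OF p n(1) K])
    have "finite L" unfolding L_def by (rule finite_subset[of _ "{0..<int p}"]) auto
    have "real (card L) / p \<le> \<epsilon> / 2"
      using \<open>real (card L) \<le> p / K\<close> large(3) by (simp add: K_def field_simps)
    then have "1 - \<epsilon> \<le> 1 - (3 + real (card L)) / p"
      unfolding add_divide_distrib using large(2) by linarith
    also have "\<dots> \<le> measure_pmf.prob
          (pair_pmf (pmf_of_set (carrier (sl2_Fp p))) (pmf_of_set (carrier (sl2_Fp p))))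
          {(A, B). ereal_of_enat (lie_diam (residue_ring (int p)) (sl2_Fp p) (sym_pair (sl2_Fp p) A B))
                     \<le> ereal (120 * ln (real p) + 8)}"
      using lie_diam_sym_pair_le[OF p p2 K n large(1) L_def]
      by (intro prob_random_sl2_pair_ge[OF p p2 \<open>finite L\<close>]) auto
    finally show "measure_pmf.prob
          (pair_pmf (pmf_of_set (carrier (sl2_Fp p))) (pmf_of_set (carrier (sl2_Fp p))))
          {(A, B). ereal_of_enat (lie_diam (residue_ring (int p)) (sl2_Fp p) (sym_pair (sl2_Fp p) A B))
                     \<le> ereal (120 * ln (real p) + 8)}
        \<ge> 1 - \<epsilon>" .
  qed
qed (simp_all add: small_set_def)

end
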